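(* Let $H_1$ and $H_2$ be Hilbert spaces and let $(S,T)$ be a Fredholm pair with $S\in L(H_1,H_2)$ and $T\in L(H_2,H_1)$. Then there is an $\epsilon>0$ such that, for all $S_1\in L(H_1,H_2)$ and $T_1\in L(H_2,H_1)$ for which $R(T_1S_1)$ and $R(S_1T_1)$ are finite dimensional subspaces of $H_1$ and $H_2$ respectively, if $\|S-S_1\|<\epsilon$ and $\|T-T_1\|<\epsilon$, then $(S_1,T_1)$ is a Fredholm pair and $\operatorname{ind}(S,T)=\operatorname{ind}(S_1,T_1)$.
   Context: For Hilbert spaces $H_1,H_2$, $L(H_1,H_2)$ denotes the bounded linear maps from $H_1$ to $H_2$. $N(\cdot)$ and $R(\cdot)$ denote null space and range. A pair $(S,T)$ with $S\in L(H_1,H_2)$, $T\in L(H_2,H_1)$ is called a Fredholm pair if the following dimensions are all finite: $a=\dim N(S)/(N(S)\cap R(T))$, $b=\dim R(T)/(N(S)\cap R(T))$, $c=\dim N(T)/(N(T)\cap R(S))$, $d=\dim R(S)/(N(T)\cap R(S))$. The index of a Fredholm pair is $\operatorname{ind}(S,T)=a-b-c+d$. *)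

theory Defs
  imports "HOL-Analysis.Analysis" "HOL-Library.Set_Algebras"
begin

text \<open>The scalar field is the real or the complex numbers. The axioms below admit no others: for
  every \<open>x\<close>, both \<open>x * sconj x\<close> and \<open>x + sconj x\<close> are real (expand \<open>(x + 1) * sconj (x + 1)\<close>), so
  \<open>x\<close> is a root of a monic real quadratic, and the field has degree at most two over the reals.
  It also follows that \<open>sconj\<close> is the identity or complex conjugation, respectively.\<close>

class real_or_complex = real_normed_field +
  fixes sconj :: "'a \<Rightarrow> 'a"
  assumes sconj_add: "sconj (x + y) = sconj x + sconj y"
    and mult_sconj: "x * sconj x = (norm x)\<^sup>2 *\<^sub>R 1"

instantiation real :: real_or_complex
begin
definition sconj_real :: "real \<Rightarrow> real" where "sconj_real x = x"
instance by standard (simp_all add: sconj_real_def power2_eq_square)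
end

instantiation complex :: real_or_complex
begin
definition sconj_complex :: "complex \<Rightarrow> complex" where "sconj_complex = cnj"
instance by standard (simp_all add: sconj_complex_def scaleR_conv_of_real complex_norm_square del: of_real_power)
end

text \<open>A Hilbert space is a Banach space (for its underlying real structure) whose norm comes from
  an inner product with values in the scalar field, linear in the first argument.
  Positive definiteness of \<open>ip\<close> is implied by \<open>ip_self\<close>.\<close>

locale hilbert_space = vector_space scale
  for scale :: "'k::real_or_complex \<Rightarrow> 'a::banach \<Rightarrow> 'a" +
  fixes ip :: "'a \<Rightarrow> 'a \<Rightarrow> 'k"
  assumes scale_of_real: "scale (of_real r) x = r *\<^sub>R x"
    and ip_add_left: "ip (x + y) z = ip x z + ip y z"
    and ip_scale_left: "ip (scale k x) y = k * ip x y"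
    and ip_sconj: "ip y x = sconj (ip x y)"
    and ip_self: "ip x x = of_real ((norm x)\<^sup>2)"

lemma hilbert_space_real:
  "hilbert_space scaleR (inner :: 'a::{real_inner, banach} \<Rightarrow> 'a \<Rightarrow> real)"
  by unfold_locales
    (simp_all add: sconj_real_def inner_commute power2_norm_eq_inner algebra_simps)

lemma hilbert_space_complex:
  "hilbert_space (*) (\<lambda>x y. x * cnj y)"
  by unfold_locales
    (simp_all add: sconj_complex_def algebra_simps scaleR_conv_of_real complex_norm_square del: of_real_power)

text \<open>The type \<open>'a \<Rightarrow>\<^sub>L 'b\<close> only records real linearity; its norm is the operator norm.\<close>

definition bounded_operators ::
  "('k \<Rightarrow> 'a \<Rightarrow> 'a) \<Rightarrow> ('k \<Rightarrow> 'b \<Rightarrow> 'b) \<Rightarrow> ('a::real_normed_vector \<Rightarrow>\<^sub>L 'b::real_normed_vector) set" where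
  "bounded_operators sc1 sc2 = {S. \<forall>k x. blinfun_apply S (sc1 k x) = sc2 k (blinfun_apply S x)}"

definition null_space :: "('a::real_normed_vector \<Rightarrow>\<^sub>L 'b::real_normed_vector) \<Rightarrow> 'a set" where
  "null_space S = {x. blinfun_apply S x = 0}"

definition range_space :: "('a::real_normed_vector \<Rightarrow>\<^sub>L 'b::real_normed_vector) \<Rightarrow> 'b set" where
  "range_space S = range (blinfun_apply S)"

definition finite_dimensional ::
  "('k::field \<Rightarrow> 'a::ab_group_add \<Rightarrow> 'a) \<Rightarrow> 'a set \<Rightarrow> bool" where
  "finite_dimensional sc V \<longleftrightarrow> (\<exists>B. finite B \<and> module.span sc B = V)"

text \<open>For subspaces \<open>W \<subseteq> V\<close>, the elements of \<open>V / W\<close> are the cosets \<open>x +o W\<close>. Cosets are added as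
  sets. A scalar multiple is taken elementwise, except that \<open>W\<close> has to be added when the scalar
  is zero; the summand \<open>W\<close> in \<open>quotient_comb\<close> does this, and makes the empty combination \<open>W\<close>,
  the zero of \<open>V / W\<close>.\<close>

definition quotient_space :: "'a::ab_group_add set \<Rightarrow> 'a set \<Rightarrow> 'a set set" where
  "quotient_space V W = (\<lambda>x. x +o W) ` V"

definition quotient_comb ::
  "('k::field \<Rightarrow> 'a::ab_group_add \<Rightarrow> 'a) \<Rightarrow> 'a set \<Rightarrow> ('a set \<Rightarrow> 'k) \<Rightarrow> 'a set set \<Rightarrow> 'a set" where
  "quotient_comb sc W c C = W + (\<Sum>X\<in>C. sc (c X) ` X)"

definition quotient_basis ::
  "('k::field \<Rightarrow> 'a::ab_group_add \<Rightarrow> 'a) \<Rightarrow> 'a set \<Rightarrow> 'a set \<Rightarrow> 'a set set \<Rightarrow> bool" where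
  "quotient_basis sc V W C \<longleftrightarrow>
     C \<subseteq> quotient_space V W \<and>
     (\<forall>c. quotient_comb sc W c C = W \<longrightarrow> (\<forall>X\<in>C. c X = 0)) \<and>
     (\<forall>X\<in>quotient_space V W. \<exists>c. quotient_comb sc W c C = X)"

definition quotient_finite_dim ::
  "('k::field \<Rightarrow> 'a::ab_group_add \<Rightarrow> 'a) \<Rightarrow> 'a set \<Rightarrow> 'a set \<Rightarrow> bool" where
  "quotient_finite_dim sc V W \<longleftrightarrow> (\<exists>C. finite C \<and> quotient_basis sc V W C)"

text \<open>Only meaningful if \<open>quotient_finite_dim sc V W\<close> holds.\<close>

definition quotient_dim ::
  "('k::field \<Rightarrow> 'a::ab_group_add \<Rightarrow> 'a) \<Rightarrow> 'a set \<Rightarrow> 'a set \<Rightarrow> nat" where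
  "quotient_dim sc V W = card (SOME C. finite C \<and> quotient_basis sc V W C)"

text \<open>Linear combinations of cosets are the cosets of the linear combinations of representatives.\<close>

lemma quotient_comb_representatives:
  assumes "vector_space sc" and W: "module.subspace sc W"
    and "finite C" and "\<And>X. X \<in> C \<Longrightarrow> X = r X +o W"
  shows "quotient_comb sc W c C = (\<Sum>X\<in>C. sc (c X) (r X)) +o W"
proof -
  interpret vector_space sc by fact
  have WW: "W + W = W"
  proof
    show "W + W \<subseteq> W"
      using W by (auto simp: set_plus_def subspace_add)
    show "W \<subseteq> W + W"
    proof
      fix w assume "w \<in> W"
      then have "w + 0 \<in> W + W"
        using subspace_0[OF W] by (rule set_plus_intro)
      then show "w \<in> W + W" by simp
    qed
  qed
  have step: "W + sc k ` (x +o W) = sc k x +o W" for k x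
  proof (intro set_eqI iffI)
    fix y assume "y \<in> W + sc k ` (x +o W)"
    then obtain v w where "v \<in> W" "w \<in> W" "y = v + sc k (x + w)"
      by (auto simp: set_plus_def elt_set_plus_def)
    moreover have "v + sc k w \<in> W"
      using calculation W by (simp add: subspace_add subspace_scale)
    ultimately show "y \<in> sc k x +o W"
      by (auto simp: elt_set_plus_def scale_right_distrib intro!: bexI[of _ "v + sc k w"])
  next
    fix y assume "y \<in> sc k x +o W"
    then obtain w where "w \<in> W" "y = w + sc k (x + 0)"
      by (auto simp: elt_set_plus_def add.commute)
    then show "y \<in> W + sc k ` (x +o W)"
      using subspace_0[OF W] by (force simp: set_plus_def elt_set_plus_def)
  qed
  show ?thesis
    using assms(3,4)
  proof (induction C rule: finite_induct)
    case empty
    then show ?case by (simp add: quotient_comb_def)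
  next
    case (insert X C)
    have IH: "quotient_comb sc W c C = (\<Sum>X\<in>C. sc (c X) (r X)) +o W"
      by (rule insert.IH) (use insert.prems in auto)
    have "quotient_comb sc W c (insert X C) = (W + W) + (sc (c X) ` X + (\<Sum>X\<in>C. sc (c X) ` X))"
      using insert.hyps by (simp add: quotient_comb_def WW)
    also have "\<dots> = (W + sc (c X) ` X) + quotient_comb sc W c C"
      unfolding quotient_comb_def by (simp only: ac_simps)
    also have "W + sc (c X) ` X = sc (c X) (r X) +o W"
      using step[of "c X" "r X"] insert.prems[of X, symmetric] by simp
    also have "\<dots> + quotient_comb sc W c C
        = (sc (c X) (r X) + (\<Sum>X\<in>C. sc (c X) (r X))) +o (W + W)"
      unfolding IH by (simp only: set_plus_rearrange)
    finally show ?case using insert.hyps by (simp add: WW)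
  qed
qed

definition fredholm_pair ::
  "('k::field \<Rightarrow> 'a \<Rightarrow> 'a) \<Rightarrow> ('k \<Rightarrow> 'b \<Rightarrow> 'b) \<Rightarrow>
   ('a::real_normed_vector \<Rightarrow>\<^sub>L 'b::real_normed_vector) \<Rightarrow> ('b \<Rightarrow>\<^sub>L 'a) \<Rightarrow> bool" where
  "fredholm_pair sc1 sc2 S T \<longleftrightarrow>
     S \<in> bounded_operators sc1 sc2 \<and> T \<in> bounded_operators sc2 sc1 \<and>
     quotient_finite_dim sc1 (null_space S) (null_space S \<inter> range_space T) \<and>
     quotient_finite_dim sc1 (range_space T) (null_space S \<inter> range_space T) \<and>
     quotient_finite_dim sc2 (null_space T) (null_space T \<inter> range_space S) \<and>
     quotient_finite_dim sc2 (range_space S) (null_space T \<inter> range_space S)"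

definition fredholm_index ::
  "('k::field \<Rightarrow> 'a \<Rightarrow> 'a) \<Rightarrow> ('k \<Rightarrow> 'b \<Rightarrow> 'b) \<Rightarrow>
   ('a::real_normed_vector \<Rightarrow>\<^sub>L 'b::real_normed_vector) \<Rightarrow> ('b \<Rightarrow>\<^sub>L 'a) \<Rightarrow> int" where
  "fredholm_index sc1 sc2 S T =
     int (quotient_dim sc1 (null_space S) (null_space S \<inter> range_space T))
     - int (quotient_dim sc1 (range_space T) (null_space S \<inter> range_space T))
     - int (quotient_dim sc2 (null_space T) (null_space T \<inter> range_space S))
     + int (quotient_dim sc2 (range_space S) (null_space T \<inter> range_space S))"

end

theory Submission
  imports Defs
begin

text \<open>Call two subspaces commensurable if each is contained in the other up to finite dimension,
  and let \<open>[A : B] = dim A / (A \<inter> B) - dim B / (A \<inter> B)\<close> be their relative index, which adds up along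
  chains. A pair \<open>(S, T)\<close> is Fredholm if and only if \<open>N(S)\<close> is commensurable with \<open>R(T)\<close> and \<open>N(T)\<close> with
  \<open>R(S)\<close>, and then its index is \<open>[N(S) : R(T)] - [N(T) : R(S)]\<close>
  (\<open>fredholm_pair_iff_commensurable_pair\<close>).

  The idea is to replace the pair by a single operator. Let \<open>T'\<close> be an outer inverse of \<open>T\<close>, that is
  \<open>T' T T' = T'\<close>, and let \<open>U = S + T'\<close>. If \<open>S T\<close> and \<open>T S\<close> have finite rank and \<open>U\<close> is a Fredholm
  operator, then \<open>(S, T)\<close> is a Fredholm pair with the index of \<open>U\<close> (\<open>pair_index_eq_map_index\<close>). Indeed, up to
  perturbations of finite rank, \<open>U\<close> is block diagonal with one bijective block, and its kernel and
  cokernel are \<open>N(S) / R(T)\<close> and \<open>N(T) / R(S)\<close>; such perturbations change the relative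
  indices of null spaces and of ranges by opposite amounts (\<open>finite_rank_perturbation\<close>). This is purely
  algebraic.

  The index of \<open>U\<close> can be read off from an outer inverse \<open>V\<close> of \<open>U\<close>: it is the codimension of
  \<open>R(V)\<close> minus the dimension of \<open>N(V)\<close> (\<open>map_index_outer_inverse\<close>). And outer inverses are
  stable: an operator \<open>U1\<close> near \<open>U\<close> has an outer inverse near \<open>V\<close> with exactly the same null space and
  range (\<open>outer_inverse_perturbation\<close>). This is used twice. First it turns \<open>T'\<close> into an outer inverse \<open>T1'\<close> of \<open>T1\<close>
  such that \<open>S1 + T1'\<close> is near \<open>S + T'\<close>, then it turns \<open>V\<close> into an outer inverse of
  \<open>S1 + T1'\<close>. So \<open>S + T'\<close> and \<open>S1 + T1'\<close> have the same index, and the same holds for the two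
  pairs, since the products of \<open>S1\<close> and \<open>T1\<close> have finite rank by assumption and those of
  \<open>S\<close> and \<open>T\<close> because \<open>(S, T)\<close> is a Fredholm pair.

  The geometry of Hilbert spaces and the open mapping theorem provide the bounded operators
  \<open>T'\<close> and \<open>V\<close> for the given pair (\<open>exists_bounded_outer_inverse\<close>,
  \<open>fredholm_pair_outer_inverses\<close>).\<close>

section \<open>Dimensions and indices relative to a subspace\<close>

text \<open>A locale of its own keeps the notions below apart from the
  many interpretations of \<^locale>\<open>vector_space\<close>, to which they would otherwise be added.\<close>

locale linear_space = vector_space scale
  for scale :: "'a::field \<Rightarrow> 'b::ab_group_add \<Rightarrow> 'b"
begin

text \<open>For subspaces this says that \<open>A / (A \<inter> B)\<close> has finite dimension. Allowing arbitrary
  sets makes the relation a preorder that is preserved by images and unions without side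
  conditions; it serves as the calculus of "up to finite dimension".\<close>

definition almost_in :: "'b set \<Rightarrow> 'b set \<Rightarrow> bool" where
  "almost_in A B \<longleftrightarrow> (\<exists>F. finite F \<and> A \<subseteq> span (B \<union> F))"

text \<open>Representatives in \<open>V\<close> of a finite basis of \<open>V / W\<close>.\<close>

definition mod_basis :: "'b set \<Rightarrow> 'b set \<Rightarrow> 'b set \<Rightarrow> bool" where
  "mod_basis V W B \<longleftrightarrow> finite B \<and> B \<subseteq> V \<and> V \<subseteq> span (W \<union> B) \<and>
     (\<forall>c. (\<Sum>b\<in>B. scale (c b) b) \<in> W \<longrightarrow> (\<forall>b\<in>B. c b = 0))"

definition relative_dim :: "'b set \<Rightarrow> 'b set \<Rightarrow> nat" where
  "relative_dim V W = card (SOME B. mod_basis V W B)"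

lemma almost_in_subset: "A \<subseteq> B \<Longrightarrow> almost_in A B"
  unfolding almost_in_def using span_superset[of B] by (intro exI[of _ "{}"]) auto

lemma almost_in_span: "almost_in (span A) A"
  unfolding almost_in_def by (intro exI[of _ "{}"]) auto

lemma almost_in_finite_span: "finite F \<Longrightarrow> A \<subseteq> span F \<Longrightarrow> almost_in A B"
  unfolding almost_in_def using span_mono[of F "B \<union> F"] by (intro exI[of _ F]) auto

lemma almost_in_trans:
  assumes "almost_in A B" "almost_in B C" shows "almost_in A C"
proof -
  obtain F G where F: "finite F" "A \<subseteq> span (B \<union> F)" and G: "finite G" "B \<subseteq> span (C \<union> G)"
    using assms unfolding almost_in_def by blast
  have "B \<union> F \<subseteq> span (C \<union> (G \<union> F))"
    using G(2) span_mono[of "C \<union> G" "C \<union> (G \<union> F)"] span_superset[of "C \<union> (G \<union> F)"] by auto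
  then have "span (B \<union> F) \<subseteq> span (C \<union> (G \<union> F))"
    by (simp add: span_minimal)
  then show ?thesis
    using F G unfolding almost_in_def by (intro exI[of _ "G \<union> F"]) auto
qed

lemma almost_in_Un:
  assumes "almost_in A C" "almost_in B C" shows "almost_in (A \<union> B) C"
proof -
  obtain F G where F: "finite F" "A \<subseteq> span (C \<union> F)" and G: "finite G" "B \<subseteq> span (C \<union> G)"
    using assms unfolding almost_in_def by blast
  then show ?thesis
    using span_mono[of "C \<union> G" "C \<union> (G \<union> F)"] span_mono[of "C \<union> F" "C \<union> (G \<union> F)"]
    unfolding almost_in_def by (intro exI[of _ "G \<union> F"]) blast
qed

lemma in_span_subspace_Un_set:
  assumes "subspace A"
  shows "x \<in> span (A \<union> B) \<longleftrightarrow> (\<exists>a\<in>A. \<exists>b\<in>span B. x = a + b)"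
proof -
  have "span A = A" using assms by (simp only: span_eq_iff)
  then show ?thesis by (simp only: span_Un) blast
qed

lemma in_span_subspace_Un:
  assumes "subspace A" "subspace B"
  shows "x \<in> span (A \<union> B) \<longleftrightarrow> (\<exists>a\<in>A. \<exists>b\<in>B. x = a + b)"
proof -
  have "span B = B" using assms(2) by (simp only: span_eq_iff)
  then show ?thesis using in_span_subspace_Un_set[OF assms(1), of x B] by (simp only:)
qed

text \<open>A linear map with kernel \<open>W\<close> stands in for the projection to the quotient by \<open>W\<close>: it
  turns bases of \<open>V\<close> modulo \<open>W\<close> into ordinary bases of the image of \<open>V\<close>, so that the
  dimension theory of subspaces applies to quotients.\<close>

lemma exists_linear_with_kernel:
  assumes "subspace W"
  obtains p where "Vector_Spaces.linear scale scale p" "\<And>x. p x = 0 \<longleftrightarrow> x \<in> W"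
proof -
  interpret vector_space_pair scale scale ..
  have "Vector_Spaces.linear scale scale (\<lambda>x. x)"
    by (rule linear_id[unfolded id_def])
  from linear_exists_left_inverse_on[OF this assms]
  obtain g where g: "g ` UNIV \<subseteq> W" "Vector_Spaces.linear scale scale g" "\<And>v. v \<in> W \<Longrightarrow> g v = v"
    by auto
  show ?thesis
  proof
    show "Vector_Spaces.linear scale scale (\<lambda>x. x - g x)"
      using g(2) by (intro linear_compose_sub linear_id[unfolded id_def])
    show "x - g x = 0 \<longleftrightarrow> x \<in> W" for x
      using g by (metis eq_iff_diff_eq_0 image_subset_iff UNIV_I)
  qed
qed

lemma mod_basis_independent:
  assumes "mod_basis V W B" "(\<Sum>b\<in>B. scale (c b) b) \<in> W" "b \<in> B"
  shows "c b = 0"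
proof -
  have "(\<Sum>b\<in>B. scale (c b) b) \<in> W \<longrightarrow> (\<forall>b\<in>B. c b = 0)"
    using assms(1) unfolding mod_basis_def by (elim conjE) (erule spec)
  then show ?thesis using assms by blast
qed

lemma mod_basis_diff:
  assumes "mod_basis V W B" "a \<in> B" "b \<in> B" "a - b \<in> W"
  shows "a = b"
proof (rule ccontr)
  assume "a \<noteq> b"
  let ?c = "\<lambda>x. if x = a then 1 else if x = b then -1 else 0"
  have "(\<Sum>x\<in>B. scale (?c x) x) = (\<Sum>x\<in>B. (if x = a then x else 0) + (if x = b then -x else 0))"
    using \<open>a \<noteq> b\<close> by (intro sum.cong) auto
  also have "\<dots> = a - b"
    using assms by (simp add: sum.distrib mod_basis_def)
  finally have "(\<Sum>x\<in>B. scale (?c x) x) \<in> W"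
    using assms(4) by simp
  from mod_basis_independent[OF assms(1) this assms(2)] show False by simp
qed

lemma mod_basis_card:
  assumes "Vector_Spaces.linear scale scale p" and ker: "\<And>x. p x = 0 \<longleftrightarrow> x \<in> W" and B: "mod_basis V W B"
  shows "card B = dim (p ` V)"
proof -
  interpret p: Vector_Spaces.linear scale scale p by fact
  have fin: "finite B" and sub: "B \<subseteq> V" and V: "V \<subseteq> span (W \<union> B)"
    and ind: "\<And>c b. (\<Sum>b\<in>B. scale (c b) b) \<in> W \<Longrightarrow> b \<in> B \<Longrightarrow> c b = 0"
    using B by (auto simp: mod_basis_def)
  have inj: "inj_on p B"
    using mod_basis_diff[OF B] by (intro inj_onI) (simp add: ker[symmetric] p.diff)
  have "independent (p ` B)"
  proof (rule independent_if_scalars_zero)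
    show "finite (p ` B)" using fin by simp
    fix f y assume 0: "(\<Sum>y\<in>p ` B. scale (f y) y) = 0" and y: "y \<in> p ` B"
    have "p (\<Sum>b\<in>B. scale (f (p b)) b) = 0"
      using 0 inj by (simp add: sum.reindex p.sum p.scale)
    then show "f y = 0"
      using ind[of "\<lambda>b. f (p b)"] y by (auto simp: ker)
  qed
  moreover have "p ` V \<subseteq> span (p ` B)"
  proof -
    have "p ` V \<subseteq> span (p ` (W \<union> B))"
      using V by (auto simp: p.span_image)
    also have "\<dots> \<subseteq> span (p ` B)"
      by (rule span_minimal) (auto simp: ker[THEN iffD2] span_base span_zero)
    finally show ?thesis .
  qed
  ultimately have "card (p ` B) = dim (p ` V)"
    using sub by (intro basis_card_eq_dim) auto
  then show ?thesis using inj by (simp add: card_image)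
qed

lemma mod_basis_card_unique:
  assumes "subspace W" "mod_basis V W B" "mod_basis V W B'"
  shows "card B = card B'"
proof -
  obtain p where "Vector_Spaces.linear scale scale p" "\<And>x. p x = 0 \<longleftrightarrow> x \<in> W"
    using exists_linear_with_kernel[OF assms(1)] by blast
  then show ?thesis using mod_basis_card assms by metis
qed

lemma relative_dim_eq:
  assumes "subspace W" "mod_basis V W B"
  shows "relative_dim V W = card B"
  unfolding relative_dim_def
  using assms(2) mod_basis_card_unique[OF assms(1) _ assms(2)] by (rule someI2)

lemma mod_basis_exists:
  assumes W: "subspace W" and "almost_in V W"
  obtains B where "mod_basis V W B"
proof -
  obtain p where p: "Vector_Spaces.linear scale scale p" and ker: "\<And>x. p x = 0 \<longleftrightarrow> x \<in> W"
    using exists_linear_with_kernel[OF W] by blast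
  interpret p: Vector_Spaces.linear scale scale p by fact
  obtain F where F: "finite F" "V \<subseteq> span (W \<union> F)"
    using assms(2) unfolding almost_in_def by blast
  obtain C where C: "C \<subseteq> p ` V" "independent C" "p ` V \<subseteq> span C"
    using maximal_independent_subset[of "p ` V"] by blast
  have "p ` V \<subseteq> span (p ` (W \<union> F))"
    using F(2) by (auto simp: p.span_image)
  also have "\<dots> \<subseteq> span (p ` F)"
    by (rule span_minimal) (auto simp: ker[THEN iffD2] span_base span_zero)
  finally have "C \<subseteq> span (p ` F)" using C(1) by blast
  then have finC: "finite C"
    using independent_span_bound[of "p ` F" C] F(1) C(2) by auto
  obtain B where B: "B \<subseteq> V" "inj_on p B" "p ` B = C"
    using C(1) unfolding subset_image_inj by blast
  have finB: "finite B" using finC B finite_image_iff by blast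
  have "mod_basis V W B"
    unfolding mod_basis_def
  proof (intro conjI allI impI ballI)
    show "V \<subseteq> span (W \<union> B)"
    proof
      fix v assume "v \<in> V"
      then have "p v \<in> p ` span B" using C(3) B(3) p.span_image by auto
      then obtain s where s: "s \<in> span B" "p v = p s" by auto
      then have "v - s \<in> W" using ker[of "v - s"] by (simp add: p.diff)
      then show "v \<in> span (W \<union> B)"
        using s(1) in_span_subspace_Un_set[OF W, of v B] by (metis diff_add_cancel)
    qed
    fix c b assume "(\<Sum>b\<in>B. scale (c b) b) \<in> W" and b: "b \<in> B"
    then have "p (\<Sum>b\<in>B. scale (c b) b) = 0" by (simp add: ker)
    then have "(\<Sum>y\<in>C. scale (c (the_inv_into B p y)) y) = 0"
      unfolding B(3)[symmetric] using B(2)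
      by (simp add: sum.reindex p.sum p.scale the_inv_into_f_f)
    from independentD[OF C(2) finC order_refl this, of "p b"] show "c b = 0"
      using b B by (auto simp: the_inv_into_f_f)
  qed (use finB B in auto)
  then show ?thesis using that by blast
qed

text \<open>A basis of \<open>A\<close> modulo \<open>B\<close> consists of elements of \<open>A\<close>, hence the remainders that it
  leaves lie not only in \<open>B\<close> but also in \<open>A\<close>.\<close>

lemma almost_in_inter:
  assumes A: "subspace A" and B: "subspace B" and "almost_in A B"
  shows "almost_in A (A \<inter> B)"
proof -
  obtain C where C: "mod_basis A B C"
    using mod_basis_exists[OF B assms(3)] .
  then have "finite C" "C \<subseteq> A" "A \<subseteq> span (B \<union> C)"
    by (auto simp: mod_basis_def)
  have "A \<subseteq> span ((A \<inter> B) \<union> C)"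
  proof
    fix a assume a: "a \<in> A"
    then obtain b s where bs: "b \<in> B" "s \<in> span C" "a = b + s"
      using \<open>A \<subseteq> span (B \<union> C)\<close> in_span_subspace_Un_set[OF B, of a C] by blast
    have "s \<in> A"
      using bs(2) span_minimal[OF \<open>C \<subseteq> A\<close> A] by blast
    then have "b \<in> A" using a bs subspace_diff[OF A, of a s] by simp
    then show "a \<in> span ((A \<inter> B) \<union> C)"
      using bs in_span_subspace_Un_set[OF subspace_inter[OF A B], of a C] by blast
  qed
  then show ?thesis
    using \<open>finite C\<close> unfolding almost_in_def by blast
qed

text \<open>The third isomorphism theorem for dimensions: bases of \<open>Z / V\<close> and \<open>V / W\<close> combine to a
  basis of \<open>Z / W\<close>.\<close>

lemma relative_dim_chain:
  assumes W: "subspace W" and V: "subspace V"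
    and "W \<subseteq> V" "V \<subseteq> Z" and fin: "almost_in Z W"
  shows "relative_dim Z W = relative_dim Z V + relative_dim V W"
proof -
  have "almost_in Z V" "almost_in V W"
    using almost_in_trans[OF fin almost_in_subset] almost_in_trans[OF almost_in_subset fin] assms
    by auto
  then obtain B C where B: "mod_basis Z V B" and C: "mod_basis V W C"
    using mod_basis_exists V W by metis
  have fB: "finite B" "B \<subseteq> Z" "Z \<subseteq> span (V \<union> B)"
    and iB: "\<And>c b. (\<Sum>b\<in>B. scale (c b) b) \<in> V \<Longrightarrow> b \<in> B \<Longrightarrow> c b = 0"
    and fC: "finite C" "C \<subseteq> V" "V \<subseteq> span (W \<union> C)"
    and iC: "\<And>c b. (\<Sum>b\<in>C. scale (c b) b) \<in> W \<Longrightarrow> b \<in> C \<Longrightarrow> c b = 0"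
    using B C by (auto simp: mod_basis_def)
  have disj: "B \<inter> C = {}"
  proof (rule ccontr)
    assume "B \<inter> C \<noteq> {}"
    then obtain b where b: "b \<in> B" "b \<in> V" using fC(2) by blast
    have "(\<Sum>x\<in>B. scale (if x = b then 1 else 0) x) = (\<Sum>x\<in>B. if x = b then x else 0)"
      by (intro sum.cong) auto
    also have "\<dots> = b" using b fB by simp
    finally show False using iB[of "\<lambda>x. if x = b then 1 else 0" b] b by simp
  qed
  have "mod_basis Z W (B \<union> C)"
    unfolding mod_basis_def
  proof (intro conjI allI impI)
    have "V \<union> B \<subseteq> span (W \<union> (B \<union> C))"
      using fC(3) span_mono[of "W \<union> C" "W \<union> (B \<union> C)"] span_superset[of "W \<union> (B \<union> C)"] by auto
    then show "Z \<subseteq> span (W \<union> (B \<union> C))"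
      using fB(3) span_minimal subspace_span by blast
    fix c assume *: "(\<Sum>b\<in>B \<union> C. scale (c b) b) \<in> W"
    have sum: "(\<Sum>b\<in>B \<union> C. scale (c b) b) = (\<Sum>b\<in>B. scale (c b) b) + (\<Sum>b\<in>C. scale (c b) b)"
      using fB fC disj by (simp add: sum.union_disjoint)
    have inV: "(\<Sum>b\<in>C. scale (c b) b) \<in> V"
      using fC V by (intro subspace_sum subspace_scale) auto
    have "(\<Sum>b\<in>B. scale (c b) b) \<in> V"
      using subspace_diff[OF V _ inV, of "\<Sum>b\<in>B \<union> C. scale (c b) b"] * sum assms(3) by auto
    then have 0: "\<And>b. b \<in> B \<Longrightarrow> c b = 0" using iB by blast
    then have "(\<Sum>b\<in>C. scale (c b) b) \<in> W" using * sum by simp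
    then show "\<forall>b\<in>B \<union> C. c b = 0" using 0 iC by blast
  qed (use fB fC assms in auto)
  then show ?thesis
    using relative_dim_eq[OF W] relative_dim_eq[OF V] B C card_Un_disjoint[OF fB(1) fC(1) disj]
    by metis
qed

text \<open>For commensurable subspaces the two quotients by the intersection are finite-dimensional,
  and the difference of their dimensions behaves like a difference of the (infinite) dimensions
  of \<open>A\<close> and \<open>B\<close>: it can be computed from any common subspace of finite codimension, and
  therefore adds up along chains.\<close>

definition commensurable :: "'b set \<Rightarrow> 'b set \<Rightarrow> bool" where
  "commensurable A B \<longleftrightarrow> almost_in A B \<and> almost_in B A"

definition relative_index :: "'b set \<Rightarrow> 'b set \<Rightarrow> int" where
  "relative_index A B = int (relative_dim A (A \<inter> B)) - int (relative_dim B (A \<inter> B))"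

lemma commensurable_sym: "commensurable A B \<Longrightarrow> commensurable B A"
  by (simp add: commensurable_def)

lemma commensurable_trans: "commensurable A B \<Longrightarrow> commensurable B C \<Longrightarrow> commensurable A C"
  using almost_in_trans[of A B C] almost_in_trans[of C B A] by (simp add: commensurable_def)

lemma relative_index_common_subspace:
  assumes "subspace A" "subspace B" "subspace D" "D \<subseteq> A" "D \<subseteq> B" "almost_in A D" "almost_in B D"
  shows "relative_index A B = int (relative_dim A D) - int (relative_dim B D)"
proof -
  have "relative_dim A D = relative_dim A (A \<inter> B) + relative_dim (A \<inter> B) D"
    and "relative_dim B D = relative_dim B (A \<inter> B) + relative_dim (A \<inter> B) D"
    using assms by (auto intro!: relative_dim_chain subspace_inter)
  then show ?thesis by (simp add: relative_index_def)
qed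

lemma relative_index_swap: "relative_index B A = - relative_index A B"
  by (simp add: relative_index_def Int_commute)

lemma relative_index_trans:
  assumes sub: "subspace A" "subspace B" "subspace C"
    and "commensurable A B" "commensurable B C"
  shows "relative_index A C = relative_index A B + relative_index B C"
proof -
  let ?D = "A \<inter> B \<inter> C"
  have com: "almost_in A B" "almost_in B A" "almost_in B C" "almost_in C B"
    using assms by (auto simp: commensurable_def)
  have AB: "almost_in A (A \<inter> B)" "almost_in B (A \<inter> B)"
    using almost_in_inter[OF sub(1,2) com(1)] almost_in_inter[OF sub(2,1) com(2)]
    by (simp_all only: Int_commute[of B A])
  have "almost_in (A \<inter> B) C"
    using almost_in_trans[OF almost_in_subset com(3)] by auto
  then have "almost_in (A \<inter> B) ?D"
    using sub by (intro almost_in_inter subspace_inter)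
  then have "almost_in A ?D" "almost_in B ?D" "almost_in C ?D"
    using almost_in_trans[OF AB(1), of ?D] almost_in_trans[OF AB(2), of ?D]
      almost_in_trans[OF com(4), of ?D] by simp_all
  moreover have "?D \<subseteq> A" "?D \<subseteq> B" "?D \<subseteq> C" "subspace ?D"
    using sub by (auto intro: subspace_inter)
  ultimately show ?thesis
    using sub by (simp add: relative_index_common_subspace[of _ _ ?D])
qed

end

section \<open>Linear maps and perturbations of finite rank\<close>

locale linear_space_pair = vs1: linear_space s1 + vs2: linear_space s2
  for s1 :: "'a::field \<Rightarrow> 'b::ab_group_add \<Rightarrow> 'b" and s2 :: "'a \<Rightarrow> 'c::ab_group_add \<Rightarrow> 'c"
begin

sublocale vector_space_pair s1 s2 ..

lemma almost_in_image:
  assumes "Vector_Spaces.linear s1 s2 f" "vs1.almost_in A B" shows "vs2.almost_in (f ` A) (f ` B)"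
proof -
  interpret f: Vector_Spaces.linear s1 s2 f by fact
  obtain F where F: "finite F" "A \<subseteq> vs1.span (B \<union> F)"
    using assms(2) unfolding vs1.almost_in_def by blast
  then have "f ` A \<subseteq> f ` vs1.span (B \<union> F)" by (intro image_mono)
  also have "\<dots> = vs2.span (f ` B \<union> f ` F)"
    by (simp only: f.span_image[symmetric] image_Un)
  finally have "f ` A \<subseteq> vs2.span (f ` B \<union> f ` F)" .
  then show ?thesis using F unfolding vs2.almost_in_def by blast
qed

text \<open>Finite-dimensional errors in the codomain can be chosen in the image of \<open>A\<close> and
  lifted to \<open>A\<close>; the kernel accounts for the ambiguity of the lift.\<close>

lemma almost_in_preimage:
  assumes "Vector_Spaces.linear s1 s2 f" and A: "vs1.subspace A"
    and im: "vs2.almost_in (f ` A) (f ` B)"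
  shows "vs1.almost_in A (B \<union> {x. f x = 0})"
proof -
  interpret f: Vector_Spaces.linear s1 s2 f by fact
  let ?N = "{x. f x = 0}"
  have "vs2.almost_in (f ` A) (vs2.span (f ` B))"
    by (rule vs2.almost_in_trans[OF im vs2.almost_in_subset[OF vs2.span_superset]])
  then obtain C where C: "vs2.mod_basis (f ` A) (vs2.span (f ` B)) C"
    by (rule vs2.mod_basis_exists[OF vs2.subspace_span])
  then have "C \<subseteq> f ` A" "finite C" by (auto simp: vs2.mod_basis_def)
  then obtain D where D: "D \<subseteq> A" "f ` D = C" "finite D"
    by (metis finite_subset_image)
  have N: "vs1.subspace ?N" by (rule f.subspace_kernel)
  have "A \<subseteq> vs1.span ((B \<union> ?N) \<union> D)"
  proof
    fix a assume "a \<in> A"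
    then have "f a \<in> vs2.span (vs2.span (f ` B) \<union> C)"
      using C by (auto simp: vs2.mod_basis_def)
    also have "\<dots> \<subseteq> vs2.span (f ` (B \<union> D))"
      unfolding D(2)[symmetric]
      by (intro vs2.span_minimal vs2.subspace_span Un_least vs2.span_mono)
        (auto intro: vs2.span_base)
    also have "\<dots> = f ` vs1.span (B \<union> D)" by (rule f.span_image)
    finally obtain s where s: "s \<in> vs1.span (B \<union> D)" "f a = f s" by auto
    then have "a - s \<in> ?N" by (simp add: f.diff)
    then have "a - s \<in> vs1.span ((B \<union> ?N) \<union> D)" by (intro vs1.span_base) auto
    moreover have "s \<in> vs1.span ((B \<union> ?N) \<union> D)"
      using s(1) vs1.span_mono[of "B \<union> D" "(B \<union> ?N) \<union> D"] by auto
    ultimately show "a \<in> vs1.span ((B \<union> ?N) \<union> D)"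
      by (metis vs1.span_add diff_add_cancel)
  qed
  then show ?thesis using D(3) unfolding vs1.almost_in_def by blast
qed

text \<open>The assumptions say that \<open>f\<close> induces an isomorphism from \<open>V / W\<close> to \<open>V' / W'\<close>.\<close>

lemma relative_dim_iso:
  assumes "Vector_Spaces.linear s1 s2 f" and V: "vs1.subspace V" and W: "vs1.subspace W" "W \<subseteq> V" and W': "vs2.subspace W'"
    and fin: "vs1.almost_in V W"
    and ker: "\<And>v. v \<in> V \<Longrightarrow> f v \<in> W' \<longleftrightarrow> v \<in> W"
    and im: "f ` V \<subseteq> V'" "V' \<subseteq> vs2.span (W' \<union> f ` V)"
  shows "vs2.relative_dim V' W' = vs1.relative_dim V W"
proof -
  interpret f: Vector_Spaces.linear s1 s2 f by fact
  obtain B where B: "vs1.mod_basis V W B"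
    by (rule vs1.mod_basis_exists[OF W(1) fin])
  have fB: "finite B" "B \<subseteq> V" "V \<subseteq> vs1.span (W \<union> B)"
    using B by (auto simp: vs1.mod_basis_def)
  have sumV: "(\<Sum>b\<in>B. s1 (c b) b) \<in> V" for c
    using fB V by (intro vs1.subspace_sum vs1.subspace_scale) auto
  have inj: "inj_on f B"
  proof (rule inj_onI)
    fix a b assume ab: "a \<in> B" "b \<in> B" "f a = f b"
    then have "f (a - b) \<in> W'" "a - b \<in> V"
      using fB(2) V W' by (auto simp: f.diff vs2.subspace_0 intro!: vs1.subspace_diff)
    then show "a = b"
      using ker vs1.mod_basis_diff[OF B ab(1,2)] by blast
  qed
  have "vs2.mod_basis V' W' (f ` B)"
    unfolding vs2.mod_basis_def
  proof (intro conjI allI impI ballI)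
    have "f ` V \<subseteq> f ` vs1.span (W \<union> B)" using fB(3) by blast
    also have "\<dots> = vs2.span (f ` W \<union> f ` B)" by (simp only: f.span_image[symmetric] image_Un)
    also have "\<dots> \<subseteq> vs2.span (W' \<union> f ` B)"
      using ker W(2) by (intro vs2.span_mono) blast
    finally have "W' \<union> f ` V \<subseteq> vs2.span (W' \<union> f ` B)"
      using vs2.span_superset by blast
    then show "V' \<subseteq> vs2.span (W' \<union> f ` B)"
      using im(2) vs2.span_minimal vs2.subspace_span by blast
    fix c y assume sum: "(\<Sum>y\<in>f ` B. s2 (c y) y) \<in> W'" and y: "y \<in> f ` B"
    have "f (\<Sum>b\<in>B. s1 (c (f b)) b) \<in> W'"
      using sum inj by (simp add: sum.reindex f.sum f.scale)
    then have "(\<Sum>b\<in>B. s1 (c (f b)) b) \<in> W"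
      using ker sumV[of "\<lambda>b. c (f b)"] by blast
    then show "c y = 0"
      using vs1.mod_basis_independent[OF B, of "\<lambda>b. c (f b)"] y by blast
  qed (use fB im in auto)
  then show ?thesis
    using vs2.relative_dim_eq[OF W'] vs1.relative_dim_eq[OF W(1) B] card_image[OF inj] by simp
qed

end

context linear_space begin

lemma relative_dim_second_iso:
  assumes A: "subspace A" and B: "subspace B" and fin: "almost_in A B"
    and Z: "A \<subseteq> Z" "B \<subseteq> Z" "Z \<subseteq> span (A \<union> B)"
  shows "relative_dim Z B = relative_dim A (A \<inter> B)"
proof -
  interpret linear_space_pair scale scale ..
  show ?thesis
    using relative_dim_iso[OF linear_id[unfolded id_def] A subspace_inter[OF A B] _ B
        almost_in_inter[OF A B fin], of Z] Z
    by (auto simp: Un_commute)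
qed

end

context linear_space_pair begin

text \<open>Rank and nullity for quotients, by passing through \<open>W + (V \<inter> ker f)\<close>: the upper quotient
  is isomorphic to the quotient of the images, the lower one to that of the kernels.\<close>

lemma relative_dim_image_kernel:
  assumes "Vector_Spaces.linear s1 s2 f" and V: "vs1.subspace V" and W: "vs1.subspace W" "W \<subseteq> V"
    and fin: "vs1.almost_in V W"
  shows "vs1.relative_dim V W
    = vs2.relative_dim (f ` V) (f ` W) + vs1.relative_dim (V \<inter> {x. f x = 0}) (W \<inter> {x. f x = 0})"
proof -
  interpret f: Vector_Spaces.linear s1 s2 f by fact
  let ?N = "{x. f x = 0}" let ?M = "vs1.span ((V \<inter> ?N) \<union> W)"
  have N: "vs1.subspace (V \<inter> ?N)" using V f.subspace_kernel by (rule vs1.subspace_inter)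
  have M: "vs1.subspace ?M" "W \<subseteq> ?M" "?M \<subseteq> V"
  proof -
    show "vs1.subspace ?M" by (rule vs1.subspace_span)
    show "W \<subseteq> ?M" using vs1.span_superset[of "(V \<inter> ?N) \<union> W"] by blast
    show "?M \<subseteq> V" using W(2) by (intro vs1.span_minimal V) blast
  qed
  have "vs1.relative_dim V W = vs1.relative_dim V ?M + vs1.relative_dim ?M W"
    using M W fin by (intro vs1.relative_dim_chain) auto
  also have "vs1.relative_dim V ?M = vs2.relative_dim (f ` V) (f ` W)"
  proof (rule relative_dim_iso[symmetric])
    show "vs1.almost_in V ?M" by (rule vs1.almost_in_trans[OF fin vs1.almost_in_subset[OF M(2)]])
    show "f v \<in> f ` W \<longleftrightarrow> v \<in> ?M" if v: "v \<in> V" for v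
    proof
      assume "f v \<in> f ` W"
      then obtain w where w: "w \<in> W" "f v = f w" by auto
      then have "v - w \<in> V \<inter> ?N"
        using v W V by (auto simp: f.diff vs1.subspace_diff)
      then show "v \<in> ?M"
        using w vs1.in_span_subspace_Un[OF N W(1)] by (metis diff_add_cancel)
    next
      assume "v \<in> ?M"
      then show "f v \<in> f ` W"
        using vs1.in_span_subspace_Un[OF N W(1)] by (auto simp: f.add)
    qed
  qed (use assms M f.subspace_image in \<open>auto intro: vs2.span_base\<close>)
  also have "vs1.relative_dim ?M W = vs1.relative_dim (V \<inter> ?N) ((V \<inter> ?N) \<inter> W)"
  proof (rule vs1.relative_dim_second_iso[OF N W(1)])
    show "vs1.almost_in (V \<inter> ?N) W"
      by (rule vs1.almost_in_trans[OF vs1.almost_in_subset fin]) blast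
  qed (use vs1.span_superset[of "(V \<inter> ?N) \<union> W"] in auto)
  also have "(V \<inter> ?N) \<inter> W = W \<inter> ?N" using W(2) by auto
  finally show ?thesis .
qed

text \<open>The maps \<open>f\<close> and \<open>g\<close> agree on the kernel of their difference, which has finite
  codimension. Rank and nullity relative to this kernel give the same total for \<open>f\<close> and \<open>g\<close>, so what
  the null space gains by a perturbation of finite rank, the range loses.\<close>

lemma finite_rank_perturbation:
  assumes f: "Vector_Spaces.linear s1 s2 f" and g: "Vector_Spaces.linear s1 s2 g"
    and fin: "vs2.almost_in (range (\<lambda>x. f x - g x)) {0}"
  shows "vs1.commensurable {x. f x = 0} {x. g x = 0}"
    and "vs2.commensurable (range f) (range g)"
    and "vs1.relative_index {x. f x = 0} {x. g x = 0} + vs2.relative_index (range f) (range g) = 0"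
proof -
  interpret f: Vector_Spaces.linear s1 s2 f by fact
  interpret g: Vector_Spaces.linear s1 s2 g by fact
  interpret d: Vector_Spaces.linear s1 s2 "\<lambda>x. f x - g x" using f g by (rule linear_compose_sub)
  let ?Z = "{x. f x - g x = 0}"
  have Z: "vs1.subspace ?Z" by (rule d.subspace_kernel)
  have "vs1.almost_in UNIV ({0} \<union> ?Z)"
    by (rule almost_in_preimage[OF d.linear_axioms vs1.subspace_UNIV]) (use fin d.zero in auto)
  then have UZ: "vs1.almost_in UNIV ?Z"
    using vs1.almost_in_trans[OF _ vs1.almost_in_subset, of _ _ ?Z] by (auto simp: f.zero g.zero)
  have eqN: "?Z \<inter> {x. f x = 0} = ?Z \<inter> {x. g x = 0}" and eqR: "f ` ?Z = g ` ?Z"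
    by (auto simp: image_iff)
  have key: "vs1.almost_in {x. h x = 0} (?Z \<inter> {x. h x = 0})" "vs2.almost_in (range h) (h ` ?Z)"
    "vs1.relative_dim UNIV ?Z
      = vs2.relative_dim (range h) (h ` ?Z) + vs1.relative_dim {x. h x = 0} (?Z \<inter> {x. h x = 0})"
    if "Vector_Spaces.linear s1 s2 h" for h
  proof -
    interpret h: Vector_Spaces.linear s1 s2 h by fact
    show "vs1.almost_in {x. h x = 0} (?Z \<inter> {x. h x = 0})"
      using vs1.almost_in_inter[OF h.subspace_kernel Z
        vs1.almost_in_trans[OF vs1.almost_in_subset UZ]] by (simp add: Int_commute)
    show "vs2.almost_in (range h) (h ` ?Z)" by (rule almost_in_image[OF that UZ])
    show "vs1.relative_dim UNIV ?Z
      = vs2.relative_dim (range h) (h ` ?Z) + vs1.relative_dim {x. h x = 0} (?Z \<inter> {x. h x = 0})"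
      using relative_dim_image_kernel[OF that vs1.subspace_UNIV Z _ UZ] by simp
  qed
  note kf = key[OF f] and kg = key[OF g, folded eqN eqR]
  have subs: "vs1.subspace {x. f x = 0}" "vs1.subspace {x. g x = 0}"
    "vs2.subspace (range f)" "vs2.subspace (range g)"
    "vs1.subspace (?Z \<inter> {x. f x = 0})" "vs2.subspace (f ` ?Z)"
    using f.subspace_kernel g.subspace_kernel f.subspace_image g.subspace_image vs1.subspace_inter Z
    by auto
  have le: "?Z \<inter> {x. f x = 0} \<subseteq> {x. f x = 0}" "?Z \<inter> {x. f x = 0} \<subseteq> {x. g x = 0}"
    "f ` ?Z \<subseteq> range f"
    by (blast, force, rule image_mono, simp)
  have "f ` ?Z \<subseteq> range g" unfolding eqR by blast
  note le = le this
  show "vs1.commensurable {x. f x = 0} {x. g x = 0}" "vs2.commensurable (range f) (range g)"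
    unfolding vs1.commensurable_def vs2.commensurable_def
    using vs1.almost_in_trans[OF kf(1) vs1.almost_in_subset[OF le(2)]]
      vs1.almost_in_trans[OF kg(1) vs1.almost_in_subset[OF le(1)]]
      vs2.almost_in_trans[OF kf(2) vs2.almost_in_subset[OF le(4)]]
      vs2.almost_in_trans[OF kg(2) vs2.almost_in_subset[OF le(3)]]
    by auto
  show "vs1.relative_index {x. f x = 0} {x. g x = 0} + vs2.relative_index (range f) (range g) = 0"
    using vs1.relative_index_common_subspace[OF subs(1,2,5) le(1,2) kf(1) kg(1)]
      vs2.relative_index_common_subspace[OF subs(3,4,6) le(3,4) kf(2) kg(2)] kf(3) kg(3)
    by simp
qed

end

section \<open>The index of a pair as the index of a single map\<close>

context linear_space begin

lemma almost_in_mono: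
  assumes "almost_in A B" "A' \<subseteq> A" "B \<subseteq> B'"
  shows "almost_in A' B'"
  by (rule almost_in_trans[OF almost_in_subset[OF assms(2)]
        almost_in_trans[OF assms(1) almost_in_subset[OF assms(3)]]])

lemma almost_in_modulo:
  assumes "almost_in C {0}" and "\<And>a. a \<in> A \<Longrightarrow> \<exists>b\<in>B. a - b \<in> C"
  shows "almost_in A B"
proof -
  obtain F where F: "finite F" "C \<subseteq> span ({0} \<union> F)"
    using assms(1) unfolding almost_in_def by blast
  have "A \<subseteq> span (B \<union> F)"
  proof
    fix a assume "a \<in> A"
    then obtain b where b: "b \<in> B" "a - b \<in> C" using assms(2) by blast
    then have "a - b \<in> span F" using F(2) by auto
    then have "a - b \<in> span (B \<union> F)" using span_mono[of F "B \<union> F"] by blast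
    moreover have "b \<in> span (B \<union> F)" using b by (auto intro: span_base)
    ultimately have "(a - b) + b \<in> span (B \<union> F)" by (rule span_add)
    then show "a \<in> span (B \<union> F)" by simp
  qed
  then show ?thesis using F(1) unfolding almost_in_def by blast
qed

lemma relative_dim_self: "subspace A \<Longrightarrow> relative_dim A A = 0"
  using relative_dim_eq[of A A "{}"] span_superset[of A] by (simp add: mod_basis_def)

lemma relative_index_superset:
  assumes "subspace A" "subspace B" "B \<subseteq> A" "almost_in A B"
  shows "relative_index A B = int (relative_dim A B)"
  using relative_index_common_subspace[of A B B] assms
  by (simp add: relative_dim_self almost_in_subset)

end

context linear_space_pair begin

definition finite_rank :: "('b \<Rightarrow> 'c) \<Rightarrow> bool" where
  "finite_rank f \<longleftrightarrow> vs2.almost_in (range f) {0}"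

definition fredholm_map :: "('b \<Rightarrow> 'c) \<Rightarrow> bool" where
  "fredholm_map f \<longleftrightarrow> vs1.almost_in {x. f x = 0} {0} \<and> vs2.almost_in UNIV (range f)"

definition map_index :: "('b \<Rightarrow> 'c) \<Rightarrow> int" where
  "map_index f = int (vs1.relative_dim {x. f x = 0} {0}) - int (vs2.relative_dim UNIV (range f))"

lemma linear_subspaces:
  assumes "Vector_Spaces.linear s1 s2 f"
  shows "vs1.subspace {x. f x = 0}" "vs2.subspace (range f)"
proof -
  interpret f: Vector_Spaces.linear s1 s2 f by fact
  show "vs1.subspace {x. f x = 0}" by (rule f.subspace_kernel)
  show "vs2.subspace (range f)" using f.subspace_image vs1.subspace_UNIV by blast
qed

text \<open>In this form the index of a map is within reach of the calculus of relative indices, although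
  neither the domain nor the codomain has a dimension.\<close>

lemma map_index_relative:
  assumes f: "Vector_Spaces.linear s1 s2 f" and "fredholm_map f"
  shows "map_index f = vs1.relative_index {x. f x = 0} {0} + vs2.relative_index (range f) UNIV"
proof -
  have "f 0 = 0" using f by (simp add: linear_0)
  then have "vs1.relative_index {x. f x = 0} {0} = int (vs1.relative_dim {x. f x = 0} {0})"
    using assms linear_subspaces[OF f]
    by (intro vs1.relative_index_superset) (auto simp: fredholm_map_def)
  moreover have "vs2.relative_index UNIV (range f) = int (vs2.relative_dim UNIV (range f))"
    using assms linear_subspaces[OF f]
    by (intro vs2.relative_index_superset) (auto simp: fredholm_map_def)
  ultimately show ?thesis
    using vs2.relative_index_swap[of UNIV "range f"] by (simp add: map_index_def)
qed

lemma fredholm_map_cong_finite_rank: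
  assumes f: "Vector_Spaces.linear s1 s2 f" and g: "Vector_Spaces.linear s1 s2 g"
    and fin: "finite_rank (\<lambda>x. f x - g x)" and fred: "fredholm_map f"
  shows "fredholm_map g" "map_index g = map_index f"
proof -
  note pert = finite_rank_perturbation[OF f g fin[unfolded finite_rank_def]]
  note sub = linear_subspaces[OF f] linear_subspaces[OF g]
  have 0: "f 0 = 0" "g 0 = 0" using f g by (simp_all add: linear_0)
  have fr: "vs1.almost_in {x. f x = 0} {0}" "vs2.almost_in UNIV (range f)"
    using fred by (auto simp: fredholm_map_def)
  show fredg: "fredholm_map g"
    using pert(1,2) vs1.almost_in_trans[OF _ fr(1), of "{x. g x = 0}"]
      vs2.almost_in_trans[OF fr(2), of "range g"]
    by (simp add: fredholm_map_def vs1.commensurable_def vs2.commensurable_def)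
  have "vs1.commensurable {x. g x = 0} {0}" "vs2.commensurable (range f) UNIV"
    using fredg fred 0 by (auto simp: fredholm_map_def vs1.commensurable_def vs2.commensurable_def
        intro: vs1.almost_in_subset vs2.almost_in_subset)
  then have "vs1.relative_index {x. f x = 0} {0}
      = vs1.relative_index {x. f x = 0} {x. g x = 0} + vs1.relative_index {x. g x = 0} {0}"
    and "vs2.relative_index (range g) UNIV
      = vs2.relative_index (range g) (range f) + vs2.relative_index (range f) UNIV"
    using sub pert(1) vs2.commensurable_sym[OF pert(2)]
    by (auto intro!: vs1.relative_index_trans vs2.relative_index_trans)
  then show "map_index g = map_index f"
    using map_index_relative[OF f fred] map_index_relative[OF g fredg] pert(3)
      vs2.relative_index_swap[of "range f" "range g"]
    by simp
qed

lemma fredholm_map_reflects_finite: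
  assumes f: "Vector_Spaces.linear s1 s2 f" and fred: "fredholm_map f" and A: "vs1.subspace A"
    and im: "vs2.almost_in (f ` A) {0}"
  shows "vs1.almost_in A {0}"
proof -
  have 0: "f 0 = 0" using f by (simp add: linear_0)
  have "vs1.almost_in A ({0} \<union> {x. f x = 0})"
    by (rule almost_in_preimage[OF f A]) (use im 0 in simp)
  moreover have "vs1.almost_in ({0} \<union> {x. f x = 0}) {0}"
    using fred vs1.almost_in_subset[of "{0}" "{0}"] by (intro vs1.almost_in_Un) (auto simp: fredholm_map_def)
  ultimately show ?thesis by (rule vs1.almost_in_trans)
qed

lemma range_almost_in_kernel:
  assumes f: "Vector_Spaces.linear s1 s2 f" and A: "vs1.subspace A"
    and im: "vs2.almost_in (f ` A) {0}"
  shows "vs1.almost_in A {x. f x = 0}"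
proof -
  have 0: "f 0 = 0" using f by (simp add: linear_0)
  then have "vs1.almost_in A ({0} \<union> {x. f x = 0})"
    by (intro almost_in_preimage[OF f A]) (use im in simp)
  moreover have "{0} \<union> {x. f x = 0} = {x. f x = 0}" using 0 by auto
  ultimately show ?thesis by simp
qed

definition commensurable_pair :: "('b \<Rightarrow> 'c) \<Rightarrow> ('c \<Rightarrow> 'b) \<Rightarrow> bool" where
  "commensurable_pair S T \<longleftrightarrow>
     vs1.commensurable {x. S x = 0} (range T) \<and> vs2.commensurable {y. T y = 0} (range S)"

definition pair_index :: "('b \<Rightarrow> 'c) \<Rightarrow> ('c \<Rightarrow> 'b) \<Rightarrow> int" where
  "pair_index S T =
     vs1.relative_index {x. S x = 0} (range T) - vs2.relative_index {y. T y = 0} (range S)"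

text \<open>The map \<open>V U\<close> is a projection onto the range of \<open>V\<close>, and \<open>U V\<close> is a projection with the
  null space of \<open>V\<close>. Hence \<open>U\<close> maps the range of \<open>V\<close> bijectively onto a complement of the null space
  of \<open>V\<close>, and its index is the difference of the two codimensions. That only the null space
  and the range of \<open>V\<close> enter makes the index of \<open>U\<close> stable.\<close>

lemma map_index_outer_inverse:
  assumes U: "Vector_Spaces.linear s1 s2 U" and V: "Vector_Spaces.linear s2 s1 V"
    and VUV: "\<And>y. V (U (V y)) = V y"
    and kerV: "vs2.almost_in {y. V y = 0} {0}" and ranV: "vs1.almost_in UNIV (range V)"
  shows "fredholm_map U"
    and "map_index U
      = int (vs1.relative_dim UNIV (range V)) - int (vs2.relative_dim {y. V y = 0} {0})"
proof -
  interpret U: Vector_Spaces.linear s1 s2 U by fact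
  interpret V: Vector_Spaces.linear s2 s1 V by fact
  interpret rev: linear_space_pair s2 s1 ..
  note subU = linear_subspaces[OF U] and subV = rev.linear_subspaces[OF V]
  have subUV: "vs2.subspace (U ` range V)" using subV(2) by (rule U.subspace_image)
  have inj: "range V \<inter> {x. U x = 0} = {0}"
  proof -
    have "V y = 0" if "U (V y) = 0" for y using that VUV[of y] by (simp add: V.zero)
    moreover have "0 \<in> range V" using V.zero by (metis rangeI)
    ultimately show ?thesis by (auto simp: U.zero)
  qed
  have "vs1.almost_in {x. U x = 0} (range V)"
    using ranV by (rule vs1.almost_in_mono) auto
  then have 1: "vs1.almost_in {x. U x = 0} {0}"
    using vs1.almost_in_inter[OF subU(1) subV(2)] inj by (simp add: Int_commute)
  have proj: "y - U (V y) \<in> {y. V y = 0}" for y by (simp add: V.diff VUV)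
  then have 2: "vs2.almost_in UNIV (U ` range V)"
    by (intro vs2.almost_in_modulo[OF kerV]) auto
  then have 3: "vs2.almost_in UNIV (range U)"
    by (rule vs2.almost_in_mono) auto
  show "fredholm_map U" using 1 3 by (simp add: fredholm_map_def)
  have "vs1.relative_dim UNIV (range V)
      = vs2.relative_dim (range U) (U ` range V) + vs1.relative_dim {x. U x = 0} {0}"
    using relative_dim_image_kernel[OF U vs1.subspace_UNIV subV(2) _ ranV] inj by simp
  moreover have "vs2.relative_dim UNIV (U ` range V)
      = vs2.relative_dim UNIV (range U) + vs2.relative_dim (range U) (U ` range V)"
    by (rule vs2.relative_dim_chain[OF subUV subU(2) _ _ 2]) auto
  moreover have "vs2.relative_dim UNIV (U ` range V) = vs2.relative_dim {y. V y = 0} {0}"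
  proof -
    have "U (V z) = 0" if "V (U (V z)) = 0" for z
      using that by (simp add: VUV U.zero)
    moreover have "0 \<in> U ` range V" using U.zero V.zero by (metis imageI rangeI)
    ultimately have "{y. V y = 0} \<inter> U ` range V = {0}"
      using V.zero by auto
    moreover have "y \<in> vs2.span ({y. V y = 0} \<union> U ` range V)" for y
      using proj[of y] vs2.in_span_subspace_Un[OF subV(1) subUV, of y]
      by (metis diff_add_cancel imageI rangeI)
    ultimately show ?thesis
      using vs2.relative_dim_second_iso[OF subV(1) subUV vs2.almost_in_mono[OF 2], of UNIV]
      by (simp add: subset_iff)
  qed
  ultimately show "map_index U
      = int (vs1.relative_dim UNIV (range V)) - int (vs2.relative_dim {y. V y = 0} {0})"
    by (simp add: map_index_def)
qed

text \<open>With the projections \<open>G = T T'\<close> on the domain and \<open>E = T' T\<close> on the codomain of \<open>S\<close>, the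
  finite rank of the products forces \<open>S\<close> to vanish on the range of \<open>G\<close> and to map into the kernel of
  \<open>E\<close>, up to finite rank. If this held exactly, and if \<open>T = T T' T\<close>, then \<open>U = S + T'\<close> would be block
  diagonal: a bijection between the ranges of \<open>G\<close> and \<open>E\<close>, and \<open>S\<close> between their
  kernels. Then the kernel of \<open>U\<close> is a copy of \<open>ker S / range T\<close> and its cokernel a copy of
  \<open>ker T / range S\<close>. The general case differs from this one by perturbations of finite rank of
  \<open>T\<close>, \<open>S\<close> and \<open>U\<close>, whose effects cancel.\<close>

lemma pair_index_eq_map_index:
  assumes S: "Vector_Spaces.linear s1 s2 S" and T: "Vector_Spaces.linear s2 s1 T"
    and T': "Vector_Spaces.linear s1 s2 T'"
    and ST: "vs2.almost_in (range (\<lambda>y. S (T y))) {0}"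
    and TS: "vs1.almost_in (range (\<lambda>x. T (S x))) {0}"
    and outer: "\<And>x. T' (T (T' x)) = T' x"
    and fred: "fredholm_map (\<lambda>x. S x + T' x)"
  shows "commensurable_pair S T" "pair_index S T = map_index (\<lambda>x. S x + T' x)"
proof -
  interpret S: Vector_Spaces.linear s1 s2 S by fact
  interpret T: Vector_Spaces.linear s2 s1 T by fact
  interpret T': Vector_Spaces.linear s1 s2 T' by fact
  interpret rev: linear_space_pair s2 s1 ..
  interpret e1: linear_space_pair s1 s1 ..
  interpret e2: linear_space_pair s2 s2 ..
  define U where "U = (\<lambda>x. S x + T' x)"
  define G where "G = (\<lambda>x. T (T' x))"
  define E where "E = (\<lambda>y. T' (T y))"
  have linU: "Vector_Spaces.linear s1 s2 U"
    unfolding U_def by (rule linear_compose_add[OF S T'])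
  have linG: "Vector_Spaces.linear s1 s1 G"
    unfolding G_def using Vector_Spaces.linear_compose[OF T' T] by (simp add: o_def)
  have linE: "Vector_Spaces.linear s2 s2 E"
    unfolding E_def using Vector_Spaces.linear_compose[OF T T'] by (simp add: o_def)
  have linTE: "Vector_Spaces.linear s2 s1 (\<lambda>y. T (E y))"
    using Vector_Spaces.linear_compose[OF linE T] by (simp add: o_def)
  interpret U: Vector_Spaces.linear s1 s2 U by (rule linU)
  interpret G: Vector_Spaces.linear s1 s1 G by (rule linG)
  interpret E: Vector_Spaces.linear s2 s2 E by (rule linE)
  have fredU: "fredholm_map U" using fred by (simp add: U_def)
  have [simp]: "E (E y) = E y" "E (T' x) = T' x" "G (G x) = G x" "T' (G x) = T' x" for x y
    by (simp_all add: E_def G_def outer)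
  have T'TS: "vs2.almost_in (T' ` range (\<lambda>x. T (S x))) {0}"
    using almost_in_image[OF T' TS] by (simp add: T'.zero)

  \<comment> \<open>The four defect spaces are finite-dimensional. On the kernel of \<open>S\<close>, the map \<open>U (1 - G)\<close>
    equals \<open>- S T T'\<close>; since \<open>U\<close> is Fredholm, \<open>1 - G\<close> itself has finite rank there.\<close>
  have NS_RT: "vs1.almost_in {x. S x = 0} (range T)"
  proof -
    have sub: "vs1.subspace ((\<lambda>x. x - G x) ` {x. S x = 0})"
    proof -
      interpret D: Vector_Spaces.linear s1 s1 "\<lambda>x. x - G x"
        by (rule e1.linear_compose_sub[OF vs1.linear_id[unfolded id_def] linG])
      show ?thesis by (rule D.subspace_image[OF S.subspace_kernel])
    qed
    have "U ` (\<lambda>x. x - G x) ` {x. S x = 0} \<subseteq> range (\<lambda>y. S (T y))"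
    proof clarify
      fix x assume "S x = 0"
      then have "U (x - G x) = S (T (T' (- x)))"
        by (simp add: U_def S.diff T'.diff T'.neg T.neg S.neg) (simp add: G_def)
      then show "U (x - G x) \<in> range (\<lambda>y. S (T y))" by simp
    qed
    then have "vs2.almost_in (U ` (\<lambda>x. x - G x) ` {x. S x = 0}) {0}"
      by (rule vs2.almost_in_trans[OF vs2.almost_in_subset ST])
    from fredholm_map_reflects_finite[OF linU fredU sub this]
    show ?thesis
      by (rule vs1.almost_in_modulo) (auto simp: G_def)
  qed
  \<comment> \<open>Almost every \<open>y\<close> in the kernel of \<open>T\<close> is \<open>S x + T' x\<close> for some \<open>x\<close>, and applying
    \<open>T' T\<close> shows that \<open>T' x = - T' T S x\<close> is confined to a finite-dimensional space.\<close>
  have NT_RS: "vs2.almost_in {y. T y = 0} (range S)"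
  proof -
    have "vs2.almost_in {y. T y = 0} (range U)"
      using fredU vs2.almost_in_mono[of UNIV "range U" "{y. T y = 0}" "range U"]
      by (simp add: fredholm_map_def)
    then have 1: "vs2.almost_in {y. T y = 0} ({y. T y = 0} \<inter> range U)"
      using T.subspace_kernel linear_subspaces(2)[OF linU] by (intro vs2.almost_in_inter)
    have 2: "vs2.almost_in ({y. T y = 0} \<inter> range U) (range S)"
    proof (rule vs2.almost_in_modulo[OF T'TS])
      fix y assume "y \<in> {y. T y = 0} \<inter> range U"
      then obtain x where x: "y = S x + T' x" "T y = 0" by (auto simp: U_def)
      have "T (T' x) = T (S (- x))"
        using x by (simp add: T.add S.neg T.neg eq_neg_iff_add_eq_0 add.commute)
      then have "T' x = T' (T (S (- x)))" using outer[of x] by simp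
      then have "y - S x \<in> T' ` range (\<lambda>x. T (S x))" using x(1) by auto
      then show "\<exists>b\<in>range S. y - b \<in> T' ` range (\<lambda>x. T (S x))" by blast
    qed
    show ?thesis by (rule vs2.almost_in_trans[OF 1 2])
  qed
  have "S ` range T = range (\<lambda>y. S (T y))" "T ` range S = range (\<lambda>x. T (S x))" by auto
  then have RT_NS: "vs1.almost_in (range T) {x. S x = 0}"
    and RS_NT: "vs2.almost_in (range S) {y. T y = 0}"
    using range_almost_in_kernel[OF S rev.linear_subspaces(2)[OF T]] ST
      rev.range_almost_in_kernel[OF T linear_subspaces(2)[OF S]] TS
    by simp_all
  have comX: "vs1.commensurable {x. S x = 0} (range T)"
    and comY: "vs2.commensurable {y. T y = 0} (range S)"
    using NS_RT RT_NS NT_RS RS_NT by (auto simp: vs1.commensurable_def vs2.commensurable_def)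
  then show "commensurable_pair S T" by (simp add: commensurable_pair_def)

  \<comment> \<open>Replacing \<open>T\<close> by \<open>T E = T T' T\<close>, which has the range of \<open>G\<close> and the kernel of \<open>E\<close>. As \<open>T'\<close>
    annihilates the difference \<open>T - T E\<close>, applying \<open>U\<close> to it leaves \<open>S (T - T E)\<close>.\<close>
  have "vs1.almost_in (range (\<lambda>y. T y - T (E y))) {0}"
  proof (rule fredholm_map_reflects_finite[OF linU fredU])
    show "vs1.subspace (range (\<lambda>y. T y - T (E y)))"
      by (intro rev.linear_subspaces rev.linear_compose_sub T linTE)
    have "U ` range (\<lambda>y. T y - T (E y)) \<subseteq> range (\<lambda>y. S (T y))"
    proof clarify
      fix y
      have "U (T y - T (E y)) = S (T (y - E y))"
        by (simp add: U_def S.diff T'.diff T.diff) (simp add: E_def outer)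
      then show "U (T y - T (E y)) \<in> range (\<lambda>y. S (T y))" by simp
    qed
    then show "vs2.almost_in (U ` range (\<lambda>y. T y - T (E y))) {0}"
      by (rule vs2.almost_in_trans[OF vs2.almost_in_subset ST])
  qed
  note pertT = rev.finite_rank_perturbation[OF T linTE this]
  have NTE: "{y. T (E y) = 0} = {y. E y = 0}"
  proof -
    have "E y = 0" if "T (E y) = 0" for y
    proof -
      have "E y = T' (T (E y))" by (simp add: E_def outer)
      then show ?thesis using that by (simp add: T'.zero)
    qed
    then show ?thesis by (auto simp: T.zero)
  qed
  have RTE: "range (\<lambda>y. T (E y)) = range G"
  proof -
    have "T (E y) = G (T y)" "G x = T (E (T' x))" for x y
      by (simp_all add: E_def G_def outer)
    then show ?thesis
      by (intro subset_antisym image_subsetI) (metis rangeI)+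
  qed

  \<comment> \<open>Replacing \<open>S\<close> by its corner \<open>S0 = (1 - E) S (1 - G)\<close>; the rest, \<open>S G + E S (1 - G)\<close>, contains a factor
    \<open>S T\<close> or \<open>T S\<close> in each summand.\<close>
  define S0 where "S0 = (\<lambda>x. S (x - G x) - E (S (x - G x)))"
  have linS0: "Vector_Spaces.linear s1 s2 S0"
  proof -
    have 1: "Vector_Spaces.linear s1 s2 (\<lambda>x. S (x - G x))"
      using Vector_Spaces.linear_compose[OF e1.linear_compose_sub[OF vs1.linear_id[unfolded id_def] linG] S]
      by (simp add: o_def)
    then show ?thesis
      using linear_compose_sub[OF 1 Vector_Spaces.linear_compose[OF 1 linE]]
      by (simp add: S0_def o_def)
  qed
  interpret S0: Vector_Spaces.linear s1 s2 S0 by (rule linS0)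
  have "vs2.almost_in (range (\<lambda>x. S x - S0 x)) (range (\<lambda>y. S (T y)))"
  proof (rule vs2.almost_in_modulo[OF T'TS])
    fix y assume "y \<in> range (\<lambda>x. S x - S0 x)"
    then obtain x where "y = S x - S0 x" by auto
    then have "y - S (T (T' x)) = T' (T (S (x - G x)))"
      by (simp add: S0_def S.diff E.diff) (simp add: E_def G_def T.diff T'.diff)
    then show "\<exists>b\<in>range (\<lambda>y. S (T y)). y - b \<in> T' ` range (\<lambda>x. T (S x))" by blast
  qed
  then have fin_S0: "vs2.almost_in (range (\<lambda>x. S x - S0 x)) {0}"
    by (rule vs2.almost_in_trans[OF _ ST])
  note pertS = finite_rank_perturbation[OF S linS0 fin_S0]
  have [simp]: "S0 (G x) = 0" "E (S0 x) = 0" for x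
    by (simp_all add: S0_def S.zero E.zero E.diff)
  define U0 where "U0 = (\<lambda>x. S0 x + T' x)"
  have linU0: "Vector_Spaces.linear s1 s2 U0"
    unfolding U0_def by (rule linear_compose_add[OF linS0 T'])
  have "finite_rank (\<lambda>x. U x - U0 x)"
    using fin_S0 by (simp add: finite_rank_def U_def U0_def)
  note fredU0 = fredholm_map_cong_finite_rank[OF linU linU0 this fredU]

  \<comment> \<open>\<open>U0\<close> is block diagonal: it maps \<open>range G\<close> onto \<open>range E\<close> by the bijection \<open>T'\<close>, and
    the kernel of \<open>G\<close> to the kernel of \<open>E\<close> by \<open>S0\<close>.\<close>
  note subS0 = linear_subspaces[OF linS0] and subU0 = linear_subspaces[OF linU0]
    and subG = e1.linear_subspaces[OF linG] and subE = e2.linear_subspaces[OF linE]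
    and subT = rev.linear_subspaces[OF T] and subS = linear_subspaces[OF S]
  have NU0: "S0 x = 0 \<and> T' x = 0" if "U0 x = 0" for x
  proof -
    have "E (U0 x) = T' x" by (simp add: U0_def E.add)
    then have "T' x = 0" using that by (simp add: E.zero)
    then show ?thesis using that by (simp add: U0_def)
  qed
  have comX0: "vs1.commensurable {x. S0 x = 0} (range G)"
    by (rule vs1.commensurable_trans[OF vs1.commensurable_sym[OF pertS(1)]
          vs1.commensurable_trans[OF comX]]) (use pertT(2) RTE in simp)
  have comY0: "vs2.commensurable {y. E y = 0} (range S0)"
    by (rule vs2.commensurable_trans[OF vs2.commensurable_sym vs2.commensurable_trans[OF comY pertS(2)]])
      (use pertT(1) NTE in simp)
  have "vs1.relative_index {x. S0 x = 0} (range G) = int (vs1.relative_dim {x. U0 x = 0} {0})"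
  proof -
    have "vs1.relative_index {x. S0 x = 0} (range G)
        = int (vs1.relative_dim {x. S0 x = 0} (range G))"
      using comX0 by (intro vs1.relative_index_superset subS0 subG)
        (auto simp: vs1.commensurable_def)
    moreover have "vs1.relative_dim {x. S0 x = 0} (range G)
        = vs1.relative_dim {x. U0 x = 0} ({x. U0 x = 0} \<inter> range G)"
    proof (rule vs1.relative_dim_second_iso[OF subU0(1) subG(2)])
      show "vs1.almost_in {x. U0 x = 0} (range G)"
        using fredU0(1) vs1.subspace_0[OF subG(2)]
          vs1.almost_in_mono[of "{x. U0 x = 0}" "{0}" "{x. U0 x = 0}" "range G"]
        by (simp add: fredholm_map_def)
      show "{x. S0 x = 0} \<subseteq> vs1.span ({x. U0 x = 0} \<union> range G)"
      proof
        fix x assume "x \<in> {x. S0 x = 0}"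
        then have "x - G x \<in> {x. U0 x = 0}" by (simp add: U0_def S0.diff T'.diff)
        then have "\<exists>a\<in>{x. U0 x = 0}. \<exists>b\<in>range G. x = a + b"
          by (intro bexI[of _ "x - G x"] bexI[of _ "G x"]) auto
        then show "x \<in> vs1.span ({x. U0 x = 0} \<union> range G)"
          by (simp only: vs1.in_span_subspace_Un[OF subU0(1) subG(2)])
      qed
    qed (use NU0 in auto)
    moreover have "{x. U0 x = 0} \<inter> range G = {0}"
    proof -
      have "G z = 0" if "U0 (G z) = 0" for z
        using NU0[OF that] by (simp add: G_def outer T.zero)
      moreover have "U0 0 = 0" by (simp add: U0_def S0.zero T'.zero)
      moreover have "0 \<in> range G" by (rule vs1.subspace_0[OF subG(2)])
      ultimately show ?thesis by auto
    qed
    ultimately show ?thesis by simp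
  qed
  moreover have "vs2.relative_index {y. E y = 0} (range S0) = int (vs2.relative_dim UNIV (range U0))"
  proof -
    have "vs2.relative_index {y. E y = 0} (range S0)
        = int (vs2.relative_dim {y. E y = 0} (range S0))"
      using comY0 by (intro vs2.relative_index_superset subS0 subE)
        (auto simp: vs2.commensurable_def)
    moreover have "vs2.relative_dim UNIV (range U0)
        = vs2.relative_dim {y. E y = 0} ({y. E y = 0} \<inter> range U0)"
    proof (rule vs2.relative_dim_second_iso[OF subE(1) subU0(2)])
      show "vs2.almost_in {y. E y = 0} (range U0)"
        using fredU0(1) vs2.almost_in_mono[of UNIV "range U0" "{y. E y = 0}" "range U0"]
        by (simp add: fredholm_map_def)
      show "UNIV \<subseteq> vs2.span ({y. E y = 0} \<union> range U0)"
      proof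
        fix y
        have "E y = U0 (G (T y))" by (simp add: U0_def) (simp add: E_def)
        then have "E y \<in> range U0" by (metis rangeI)
        moreover have "y - E y \<in> {y. E y = 0}" by (simp add: E.diff)
        moreover have "y = (y - E y) + E y" by simp
        ultimately have "\<exists>a\<in>{y. E y = 0}. \<exists>b\<in>range U0. y = a + b" by blast
        then show "y \<in> vs2.span ({y. E y = 0} \<union> range U0)"
          by (simp only: vs2.in_span_subspace_Un[OF subE(1) subU0(2)])
      qed
    qed auto
    moreover have "{y. E y = 0} \<inter> range U0 = range S0"
    proof -
      have "U0 x = S0 x" if "E (U0 x) = 0" for x
        using that by (simp add: U0_def E.add)
      then have "{y. E y = 0} \<inter> range U0 \<subseteq> range S0" by auto
      moreover have "S0 x = U0 (x - G x)" for x
        by (simp add: U0_def S0.diff T'.diff)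
      then have "range S0 \<subseteq> range U0" by (metis image_subsetI rangeI)
      moreover have "range S0 \<subseteq> {y. E y = 0}" by auto
      ultimately show ?thesis by blast
    qed
    ultimately show ?thesis by simp
  qed
  ultimately have ind0: "map_index U0
      = vs1.relative_index {x. S0 x = 0} (range G) - vs2.relative_index {y. E y = 0} (range S0)"
    by (simp add: map_index_def)

  \<comment> \<open>Going from \<open>ker S\<close> to \<open>range T\<close> via \<open>ker S0\<close> and \<open>range G\<close>, and likewise from \<open>ker T\<close> to \<open>range S\<close>,
    the outer steps cancel because \<open>S\<close>, \<open>S0\<close> and \<open>T\<close>, \<open>T E\<close> differ by finite rank.\<close>
  have "vs1.relative_index {x. S x = 0} (range T) = vs1.relative_index {x. S x = 0} {x. S0 x = 0}
      + vs1.relative_index {x. S0 x = 0} (range G) + vs1.relative_index (range G) (range T)"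
    using vs1.relative_index_trans[OF subS(1) subS0(1) subT(2) pertS(1)]
      vs1.relative_index_trans[OF subS0(1) subG(2) subT(2) comX0]
      vs1.commensurable_trans[OF vs1.commensurable_sym[OF pertS(1)] comX]
      vs1.commensurable_sym[OF pertT(2)] RTE
    by simp
  moreover have "vs2.relative_index {y. T y = 0} (range S) = vs2.relative_index {y. T y = 0} {y. E y = 0}
      + vs2.relative_index {y. E y = 0} (range S0) + vs2.relative_index (range S0) (range S)"
    using vs2.relative_index_trans[OF subT(1) subE(1) subS(2)]
      vs2.relative_index_trans[OF subE(1) subS0(2) subS(2) comY0]
      vs2.commensurable_trans[OF vs2.commensurable_sym[OF pertT(1)] comY]
      vs2.commensurable_sym[OF pertS(2)] pertT(1) NTE
    by simp
  moreover have "vs1.relative_index (range G) (range T) = - vs1.relative_index (range T) (range G)"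
    "vs2.relative_index (range S0) (range S) = - vs2.relative_index (range S) (range S0)"
    by (rule vs1.relative_index_swap vs2.relative_index_swap)+
  ultimately have "pair_index S T = map_index U0"
    using pertS(3) pertT(3) ind0 RTE NTE by (simp add: pair_index_def)
  then show "pair_index S T = map_index (\<lambda>x. S x + T' x)"
    using fredU0(2) by (simp add: U_def)
qed

end

section \<open>Bases of quotient spaces\<close>

context linear_space begin

lemma coset_eq_iff:
  assumes "subspace W"
  shows "x +o W = y +o W \<longleftrightarrow> x - y \<in> W"
proof
  assume "x +o W = y +o W"
  moreover have "x + 0 \<in> x +o W" using subspace_0[OF assms] by (rule set_plus_intro2)
  ultimately obtain w where "w \<in> W" "x = y + w" by (auto simp: elt_set_plus_def)
  then show "x - y \<in> W" by simp
next
  assume d: "x - y \<in> W"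
  show "x +o W = y +o W"
  proof (intro set_eqI iffI)
    fix z assume "z \<in> x +o W"
    then have "z - x \<in> W" by (auto simp: elt_set_plus_def)
    then have "(z - x) + (x - y) \<in> W" using d by (rule subspace_add[OF assms])
    then show "z \<in> y +o W" by (auto simp: elt_set_plus_def intro: bexI[of _ "z - y"])
  next
    fix z assume "z \<in> y +o W"
    then have "z - y \<in> W" by (auto simp: elt_set_plus_def)
    then have "(z - y) - (x - y) \<in> W" using d by (rule subspace_diff[OF assms])
    then show "z \<in> x +o W" by (auto simp: elt_set_plus_def intro: bexI[of _ "z - x"])
  qed
qed

lemma coset_eq_subspace_iff:
  assumes "subspace W"
  shows "x +o W = W \<longleftrightarrow> x \<in> W"
  using coset_eq_iff[OF assms, of x 0] by simp

lemma quotient_comb_eq: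
  assumes "subspace W" "finite C" "\<And>X. X \<in> C \<Longrightarrow> X = r X +o W"
  shows "quotient_comb scale W c C = (\<Sum>X\<in>C. scale (c X) (r X)) +o W"
  by (rule quotient_comb_representatives[OF vector_space_axioms assms(1,2)]) (rule assms(3))

text \<open>Combinations of cosets are the cosets of combinations of representatives. Hence
  representatives of a basis of cosets are linearly independent modulo \<open>W\<close>, and there are as many of
  them as there are cosets in the basis.\<close>

lemma mod_basis_of_quotient_basis:
  assumes W: "subspace W" and "finite C" and C: "quotient_basis scale V W C"
  obtains B where "mod_basis V W B" "card B = card C"
proof -
  have sub: "C \<subseteq> (\<lambda>x. x +o W) ` V"
    and ind: "\<And>c X. quotient_comb scale W c C = W \<Longrightarrow> X \<in> C \<Longrightarrow> c X = 0"
    and gen: "\<And>v. v \<in> V \<Longrightarrow> \<exists>c. quotient_comb scale W c C = v +o W"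
    using C by (auto simp: quotient_basis_def quotient_space_def)
  have "\<forall>X\<in>C. \<exists>x. x \<in> V \<and> X = x +o W" using sub by auto
  then obtain r where rV: "\<And>X. X \<in> C \<Longrightarrow> r X \<in> V" and r: "\<And>X. X \<in> C \<Longrightarrow> X = r X +o W"
    by metis
  have inj: "inj_on r C"
  proof (rule inj_onI)
    fix X Y assume "X \<in> C" "Y \<in> C" "r X = r Y"
    then show "X = Y" using r[of X] r[of Y] by simp
  qed
  have comb: "quotient_comb scale W c C = (\<Sum>X\<in>C. scale (c X) (r X)) +o W" for c
    by (rule quotient_comb_eq[OF W \<open>finite C\<close> r])
  have "mod_basis V W (r ` C)"
    unfolding mod_basis_def
  proof (intro conjI allI impI ballI)
    show "V \<subseteq> span (W \<union> r ` C)"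
    proof
      fix v assume "v \<in> V"
      then obtain c where "quotient_comb scale W c C = v +o W" using gen by blast
      then have "v +o W = (\<Sum>X\<in>C. scale (c X) (r X)) +o W" by (simp add: comb)
      then have "v - (\<Sum>X\<in>C. scale (c X) (r X)) \<in> W" by (simp add: coset_eq_iff[OF W])
      moreover have "(\<Sum>X\<in>C. scale (c X) (r X)) \<in> span (r ` C)"
        by (intro span_sum span_scale span_base) simp
      moreover have "v = (v - (\<Sum>X\<in>C. scale (c X) (r X))) + (\<Sum>X\<in>C. scale (c X) (r X))" by simp
      ultimately show "v \<in> span (W \<union> r ` C)"
        unfolding in_span_subspace_Un_set[OF W] by blast
    qed
    fix c b assume 0: "(\<Sum>b\<in>r ` C. scale (c b) b) \<in> W" and b: "b \<in> r ` C"
    then have "(\<Sum>X\<in>C. scale (c (r X)) (r X)) \<in> W" by (simp add: sum.reindex[OF inj])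
    then have "quotient_comb scale W (\<lambda>X. c (r X)) C = W"
      by (simp add: comb coset_eq_subspace_iff[OF W])
    then show "c b = 0" using ind[of "\<lambda>X. c (r X)"] b by blast
  qed (use \<open>finite C\<close> rV in auto)
  then show ?thesis using that card_image[OF inj] by blast
qed

lemma quotient_basis_of_mod_basis:
  assumes W: "subspace W" and B: "mod_basis V W B"
  shows "quotient_basis scale V W ((\<lambda>x. x +o W) ` B)"
proof -
  let ?q = "\<lambda>x. x +o W" let ?C = "?q ` B" let ?r = "the_inv_into B ?q"
  have fB: "finite B" "B \<subseteq> V" "V \<subseteq> span (W \<union> B)"
    using B by (auto simp: mod_basis_def)
  have inj: "inj_on ?q B"
    using mod_basis_diff[OF B] by (auto simp: inj_on_def coset_eq_iff[OF W])
  have r: "?r (?q b) = b" if "b \<in> B" for b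
    using the_inv_into_f_f[OF inj that] .
  have comb: "quotient_comb scale W c ?C = (\<Sum>b\<in>B. scale (c (?q b)) b) +o W" for c
  proof -
    have "quotient_comb scale W c ?C = (\<Sum>X\<in>?C. scale (c X) (?r X)) +o W"
      by (rule quotient_comb_eq[OF W]) (use fB r in auto)
    also have "(\<Sum>X\<in>?C. scale (c X) (?r X)) = (\<Sum>b\<in>B. scale (c (?q b)) b)"
      by (simp add: sum.reindex[OF inj] r)
    finally show ?thesis .
  qed
  show ?thesis
    unfolding quotient_basis_def
  proof (intro conjI allI impI ballI)
    show "?C \<subseteq> quotient_space V W" using fB by (auto simp: quotient_space_def)
    fix c X assume "quotient_comb scale W c ?C = W" and X: "X \<in> ?C"
    then have "(\<Sum>b\<in>B. scale (c (?q b)) b) \<in> W"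
      by (simp add: comb coset_eq_subspace_iff[OF W])
    then have "c (?q b) = 0" if "b \<in> B" for b
      using mod_basis_independent[OF B, of "\<lambda>b. c (?q b)"] that by blast
    then show "c X = 0" using X by blast
  next
    fix X assume "X \<in> quotient_space V W"
    then obtain v where v: "v \<in> V" "X = v +o W" by (auto simp: quotient_space_def)
    then obtain w s where ws: "w \<in> W" "s \<in> span B" "v = w + s"
      using fB(3) in_span_subspace_Un_set[OF W, of v B] by blast
    then obtain u where "s = (\<Sum>b\<in>B. scale (u b) b)"
      using span_finite[OF fB(1)] by auto
    moreover have "(\<Sum>b\<in>B. scale (u (?r (?q b))) b) = (\<Sum>b\<in>B. scale (u b) b)"
      by (rule sum.cong) (simp_all add: r)
    ultimately have "quotient_comb scale W (\<lambda>X. u (?r X)) ?C = s +o W" by (simp add: comb)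
    also have "\<dots> = X"
      using ws v subspace_neg[OF W ws(1)] by (simp add: coset_eq_iff[OF W])
    finally show "\<exists>c. quotient_comb scale W c ?C = X" by blast
  qed
qed

lemma quotient_finite_dim_iff:
  assumes "subspace W"
  shows "quotient_finite_dim scale V W \<longleftrightarrow> almost_in V W"
proof
  assume "quotient_finite_dim scale V W"
  then obtain C where "finite C" "quotient_basis scale V W C"
    by (auto simp: quotient_finite_dim_def)
  then obtain B where "mod_basis V W B"
    by (rule mod_basis_of_quotient_basis[OF assms])
  then show "almost_in V W" by (auto simp: mod_basis_def almost_in_def)
next
  assume "almost_in V W"
  then obtain B where B: "mod_basis V W B" by (rule mod_basis_exists[OF assms])
  then have "finite ((\<lambda>x. x +o W) ` B)" by (simp add: mod_basis_def)
  then show "quotient_finite_dim scale V W"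
    using quotient_basis_of_mod_basis[OF assms B] by (auto simp: quotient_finite_dim_def)
qed

lemma quotient_dim_eq:
  assumes W: "subspace W" and fin: "almost_in V W"
  shows "quotient_dim scale V W = relative_dim V W"
proof -
  let ?P = "\<lambda>C. finite C \<and> quotient_basis scale V W C"
  have "\<exists>C. ?P C" using fin quotient_finite_dim_iff[OF W] by (simp add: quotient_finite_dim_def)
  then have "?P (SOME C. ?P C)" by (rule someI_ex)
  then obtain B where "mod_basis V W B" "card B = card (SOME C. ?P C)"
    using mod_basis_of_quotient_basis[OF W] by metis
  then show ?thesis by (simp add: quotient_dim_def relative_dim_eq[OF W])
qed

lemma quotient_finite_dim_inter_iff:
  assumes "subspace A" "subspace B"
  shows "quotient_finite_dim scale A (A \<inter> B) \<longleftrightarrow> almost_in A B"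
  using almost_in_inter[OF assms] almost_in_mono[of A "A \<inter> B" A B]
  by (auto simp: quotient_finite_dim_iff[OF subspace_inter[OF assms]])

lemma finite_dimensional_almost_in:
  assumes "finite_dimensional scale V"
  shows "almost_in V {0}"
  using assms by (auto simp: finite_dimensional_def intro: almost_in_finite_span)

end

lemma linear_of_bounded_operators:
  assumes "vector_space sc1" "vector_space sc2" "S \<in> bounded_operators sc1 sc2"
  shows "Vector_Spaces.linear sc1 sc2 (blinfun_apply S)"
  using assms
  by (simp add: Vector_Spaces.linear_iff bounded_operators_def blinfun.add_right)

text \<open>A quotient \<open>A / (A \<inter> B)\<close> has finite dimension if and only if \<open>A\<close> almost lies in \<open>B\<close>, so
  the four dimensions in the definition amount to two commensurabilities, and the four
  summands of the index to two relative indices.\<close>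

lemma fredholm_pair_iff_commensurable_pair:
  fixes sc1 :: "'k::field \<Rightarrow> 'a::real_normed_vector \<Rightarrow> 'a"
    and sc2 :: "'k \<Rightarrow> 'b::real_normed_vector \<Rightarrow> 'b"
  assumes "linear_space_pair sc1 sc2"
  shows "fredholm_pair sc1 sc2 S T \<longleftrightarrow> S \<in> bounded_operators sc1 sc2 \<and> T \<in> bounded_operators sc2 sc1
      \<and> linear_space_pair.commensurable_pair sc1 sc2 (blinfun_apply S) (blinfun_apply T)" (is ?iff)
    and "fredholm_pair sc1 sc2 S T \<Longrightarrow> fredholm_index sc1 sc2 S T
      = linear_space_pair.pair_index sc1 sc2 (blinfun_apply S) (blinfun_apply T)"
      (is "_ \<Longrightarrow> ?index")
proof -
  interpret linear_space_pair sc1 sc2 by fact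
  interpret rev: linear_space_pair sc2 sc1 ..
  have *: "(fredholm_pair sc1 sc2 S T \<longleftrightarrow> commensurable_pair (blinfun_apply S) (blinfun_apply T))
      \<and> (fredholm_pair sc1 sc2 S T
          \<longrightarrow> fredholm_index sc1 sc2 S T = pair_index (blinfun_apply S) (blinfun_apply T))"
    if S: "S \<in> bounded_operators sc1 sc2" and T: "T \<in> bounded_operators sc2 sc1"
  proof -
    have lin: "Vector_Spaces.linear sc1 sc2 (blinfun_apply S)" "Vector_Spaces.linear sc2 sc1 (blinfun_apply T)"
      using S T by (auto intro!: linear_of_bounded_operators vs1.vector_space_axioms vs2.vector_space_axioms)
    have sub: "vs1.subspace (null_space S)" "vs1.subspace (range_space T)"
      "vs2.subspace (null_space T)" "vs2.subspace (range_space S)"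
      using linear_subspaces[OF lin(1)] rev.linear_subspaces[OF lin(2)]
      by (simp_all add: null_space_def range_space_def)
    have sub': "vs1.subspace (null_space S \<inter> range_space T)" "vs2.subspace (null_space T \<inter> range_space S)"
      using sub by (auto intro: vs1.subspace_inter vs2.subspace_inter)
    note Int = Int_commute[of "range_space T"] Int_commute[of "range_space S"]
    have fred: "fredholm_pair sc1 sc2 S T \<longleftrightarrow>
        vs1.almost_in (null_space S) (range_space T) \<and> vs1.almost_in (range_space T) (null_space S) \<and>
        vs2.almost_in (null_space T) (range_space S) \<and> vs2.almost_in (range_space S) (null_space T)"
      using S T vs1.quotient_finite_dim_inter_iff[OF sub(1,2)] vs1.quotient_finite_dim_inter_iff[OF sub(2,1)]
        vs2.quotient_finite_dim_inter_iff[OF sub(3,4)] vs2.quotient_finite_dim_inter_iff[OF sub(4,3)]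
      by (simp add: fredholm_pair_def Int)
    have "fredholm_pair sc1 sc2 S T \<longleftrightarrow> commensurable_pair (blinfun_apply S) (blinfun_apply T)"
      unfolding fred
      by (auto simp: commensurable_pair_def vs1.commensurable_def vs2.commensurable_def
          null_space_def range_space_def)
    moreover have "fredholm_index sc1 sc2 S T = pair_index (blinfun_apply S) (blinfun_apply T)"
      if *: "fredholm_pair sc1 sc2 S T"
    proof -
      have "vs1.almost_in (null_space S) (null_space S \<inter> range_space T)"
        "vs1.almost_in (range_space T) (null_space S \<inter> range_space T)"
        "vs2.almost_in (null_space T) (null_space T \<inter> range_space S)"
        "vs2.almost_in (range_space S) (null_space T \<inter> range_space S)"
        using * by (simp_all add: fredholm_pair_def vs1.quotient_finite_dim_iff[OF sub'(1)]
            vs2.quotient_finite_dim_iff[OF sub'(2)])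
      then have "fredholm_index sc1 sc2 S T = vs1.relative_index (null_space S) (range_space T)
          - vs2.relative_index (null_space T) (range_space S)"
        by (simp add: fredholm_index_def vs1.relative_index_def vs2.relative_index_def
            vs1.quotient_dim_eq[OF sub'(1)] vs2.quotient_dim_eq[OF sub'(2)])
      then show ?thesis by (simp add: pair_index_def null_space_def range_space_def)
    qed
    ultimately show ?thesis by blast
  qed
  show ?iff using * by (auto simp: fredholm_pair_def)
  show ?index if "fredholm_pair sc1 sc2 S T"
    using that * by (auto simp: fredholm_pair_def)
qed

section \<open>Hilbert spaces and orthogonal projections\<close>

lemma sconj_0: "sconj (0 :: 'k::real_or_complex) = 0"
  using sconj_add[of "0 :: 'k" 0] by simp

text \<open>The axioms give additivity of the conjugation and the value of \<open>x * sconj x\<close>; its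
  multiplicativity follows through this formula.\<close>

lemma sconj_eq_divide: "sconj x = of_real ((norm x)\<^sup>2) / (x :: 'k::real_or_complex)"
  using mult_sconj[of x] by (cases "x = 0") (auto simp: sconj_0 of_real_def divide_simps mult.commute)

lemma sconj_mult: "sconj (x * y) = sconj x * sconj (y :: 'k::real_or_complex)"
  by (simp add: sconj_eq_divide norm_mult power_mult_distrib)

sublocale hilbert_space \<subseteq> linear_space scale ..

context hilbert_space begin

lemma ip_zero_left [simp]: "ip 0 x = 0"
  using ip_add_left[of 0 0 x] by simp

lemma ip_zero_right [simp]: "ip x 0 = 0"
  by (simp add: ip_sconj[of x 0] sconj_0)

lemma ip_add_right: "ip x (y + z) = ip x y + ip x z"
  by (simp add: ip_sconj[of x] ip_add_left sconj_add)

lemma ip_scale_right: "ip x (scale k y) = sconj k * ip x y"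
  by (simp add: ip_sconj[of x] ip_scale_left sconj_mult)

lemma ip_minus_left: "ip (- x) y = - ip x y"
  using ip_add_left[of x "- x" y] by (simp add: eq_neg_iff_add_eq_0 add.commute)

lemma ip_diff_left: "ip (x - y) z = ip x z - ip y z"
  using ip_add_left[of x "- y" z] by (simp add: ip_minus_left)

lemma ip_diff_right: "ip x (y - z) = ip x y - ip x z"
  using ip_add_right[of x "y - z" z] by simp

lemma ip_zero_commute: "ip x y = 0 \<longleftrightarrow> ip y x = 0"
  by (metis ip_sconj sconj_0)

lemma norm_scale: "norm (scale k x) = norm k * norm x"
proof -
  have "of_real ((norm (scale k x))\<^sup>2) = (k * sconj k) * ip x x"
    by (simp add: ip_self[symmetric] ip_scale_left ip_scale_right del: of_real_power)
  also have "\<dots> = of_real ((norm k)\<^sup>2 * (norm x)\<^sup>2)"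
    by (simp add: mult_sconj ip_self of_real_def)
  finally have "(norm (scale k x))\<^sup>2 = (norm k * norm x)\<^sup>2"
    by (simp only: of_real_eq_iff power_mult_distrib)
  then show ?thesis by (simp add: power2_eq_iff_nonneg)
qed

lemma subspace_real: "subspace W \<Longrightarrow> real_vector.subspace W"
  using subspace_scale[of W _ "of_real _"]
  by (auto simp: real_vector.subspace_def subspace_0 subspace_add scale_of_real)

lemma pythagoras:
  assumes "ip x y = 0"
  shows "(norm (x + y))\<^sup>2 = (norm x)\<^sup>2 + (norm y)\<^sup>2"
proof -
  have "of_real ((norm (x + y))\<^sup>2) = ip x x + ip y y"
    using assms by (simp add: ip_self[symmetric] ip_add_left ip_add_right ip_zero_commute[of y x] del: of_real_power)
  then have "(of_real ((norm (x + y))\<^sup>2) :: 'k) = of_real ((norm x)\<^sup>2 + (norm y)\<^sup>2)"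
    by (simp add: ip_self)
  then show ?thesis by (simp only: of_real_eq_iff)
qed

lemma parallelogram:
  fixes x y :: 'a
  shows "(norm (x + y))\<^sup>2 + (norm (x - y))\<^sup>2 = 2 * (norm x)\<^sup>2 + 2 * (norm y)\<^sup>2"
proof -
  have "ip (x + y) (x + y) + ip (x - y) (x - y) = 2 * ip x x + 2 * ip y y"
    by (simp add: ip_add_left ip_add_right ip_diff_left ip_diff_right)
  then have "(of_real ((norm (x + y))\<^sup>2 + (norm (x - y))\<^sup>2) :: 'k)
      = of_real (2 * (norm x)\<^sup>2 + 2 * (norm y)\<^sup>2)"
    by (simp add: ip_self)
  then show ?thesis by (simp only: of_real_eq_iff)
qed

text \<open>Gram-Schmidt: subtracting the component along \<open>v\<close> leaves a vector orthogonal to \<open>v\<close>.\<close>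

lemma orthogonal_component:
  assumes "v \<noteq> 0"
  shows "ip (x - scale (ip x v / of_real ((norm v)\<^sup>2)) v) v = 0"
  using assms by (simp add: ip_diff_left ip_scale_left ip_self)

lemma cauchy_schwarz: "norm (ip x v) \<le> norm x * norm v"
proof (cases "v = 0")
  case False
  let ?c = "ip x v / of_real ((norm v)\<^sup>2)"
  have "ip (x - scale ?c v) (scale ?c v) = 0"
    using orthogonal_component[OF False] by (simp add: ip_scale_right)
  from pythagoras[OF this] have "(norm (scale ?c v))\<^sup>2 \<le> (norm x)\<^sup>2" by simp
  then have "norm (scale ?c v) \<le> norm x" by (rule power2_le_imp_le) simp
  then have "norm (ip x v) / (norm v)\<^sup>2 * norm v \<le> norm x"
    by (simp add: norm_scale norm_divide del: of_real_power)
  then show ?thesis using False by (simp add: power2_eq_square field_simps)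
qed simp

text \<open>A sequence in \<open>W\<close> whose distances to \<open>x\<close> approach the infimum is Cauchy by the
  parallelogram law. Its limit is a nearest point of \<open>W\<close>, and by Pythagoras a nonzero component of \<open>x - w\<close>
  along some \<open>v\<close> in \<open>W\<close> would allow an even nearer one.\<close>

lemma exists_orthogonal_projection:
  assumes W: "subspace W" and cl: "closed W"
  obtains w where "w \<in> W" "\<And>v. v \<in> W \<Longrightarrow> ip (x - w) v = 0"
proof -
  define D where "D = Inf ((\<lambda>w. (norm (x - w))\<^sup>2) ` W)"
  have ne: "(\<lambda>w. (norm (x - w))\<^sup>2) ` W \<noteq> {}" using subspace_0[OF W] by blast
  have bdd: "bdd_below ((\<lambda>w. (norm (x - w))\<^sup>2) ` W)" by (rule bdd_belowI2[of _ 0]) simp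
  have D_le: "D \<le> (norm (x - w))\<^sup>2" if "w \<in> W" for w
    unfolding D_def using bdd that by (intro cInf_lower) auto
  have "\<exists>w\<in>W. (norm (x - w))\<^sup>2 < D + 1 / real (Suc n)" for n
  proof -
    have "D < D + 1 / real (Suc n)" by simp
    then show ?thesis
      unfolding D_def using cInf_lessD[OF ne] by blast
  qed
  then obtain w where wW: "\<And>n. w n \<in> W" and w: "\<And>n. (norm (x - w n))\<^sup>2 < D + 1 / real (Suc n)"
    by metis
  have half: "(1/2) *\<^sub>R (w m + w n) \<in> W" for m n
    unfolding scale_of_real[symmetric] using W wW by (intro subspace_scale subspace_add)
  have dist: "(norm (w m - w n))\<^sup>2 \<le> 2 * (1 / real (Suc m)) + 2 * (1 / real (Suc n))" for m n
  proof -
    have "(x - w n) + (x - w m) = 2 *\<^sub>R (x - (1/2) *\<^sub>R (w m + w n))"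
      by (simp add: algebra_simps scaleR_2)
    then have "(norm ((x - w n) + (x - w m)))\<^sup>2 = 4 * (norm (x - (1/2) *\<^sub>R (w m + w n)))\<^sup>2"
      by (simp add: power_mult_distrib)
    then have "4 * D \<le> (norm ((x - w n) + (x - w m)))\<^sup>2" using D_le[OF half, of m n] by simp
    moreover have "(x - w n) - (x - w m) = w m - w n" by simp
    ultimately show ?thesis
      using parallelogram[of "x - w n" "x - w m"] w[of n] w[of m] by (simp only:)
  qed
  have "Cauchy w"
  proof (rule metric_CauchyI)
    fix e :: real assume e: "e > 0"
    obtain M :: nat where M: "4 / e\<^sup>2 < real M" using reals_Archimedean2 by blast
    have "dist (w m) (w n) < e" if "m \<ge> M" "n \<ge> M" for m n
    proof -
      have M0: "real M > 0" using M e by (meson divide_pos_pos less_trans zero_less_numeral zero_less_power)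
      have "1 / real (Suc m) \<le> 1 / real M" "1 / real (Suc n) \<le> 1 / real M"
        using that M0 by (auto intro!: divide_left_mono)
      then have "(norm (w m - w n))\<^sup>2 \<le> 4 / real M" using dist[of m n] by simp
      also have "\<dots> < e\<^sup>2" using M M0 e by (simp add: field_simps)
      finally show ?thesis using e by (simp add: dist_norm power2_less_imp_less)
    qed
    then show "\<exists>M. \<forall>m\<ge>M. \<forall>n\<ge>M. dist (w m) (w n) < e" by blast
  qed
  then obtain l where l: "w \<longlonglongrightarrow> l" using Cauchy_convergent convergent_def by blast
  have lW: "l \<in> W" by (rule closed_sequentially[OF cl _ l]) (rule wW)
  have lD: "(norm (x - l))\<^sup>2 \<le> D"
  proof (rule LIMSEQ_le)
    show "(\<lambda>n. (norm (x - w n))\<^sup>2) \<longlonglongrightarrow> (norm (x - l))\<^sup>2" by (intro tendsto_intros l)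
    show "(\<lambda>n. D + 1 / real (Suc n)) \<longlonglongrightarrow> D"
      using tendsto_add[OF tendsto_const[of D] LIMSEQ_inverse_real_of_nat]
      by (simp add: inverse_eq_divide)
    show "\<exists>N. \<forall>n\<ge>N. (norm (x - w n))\<^sup>2 \<le> D + 1 / real (Suc n)" using w less_imp_le by blast
  qed
  have "ip (x - l) v = 0" if v: "v \<in> W" for v
  proof (cases "v = 0")
    case False
    let ?c = "ip (x - l) v / of_real ((norm v)\<^sup>2)"
    have "ip (x - l - scale ?c v) (scale ?c v) = 0"
      using orthogonal_component[OF False] by (simp add: ip_scale_right)
    from pythagoras[OF this]
    have "(norm (x - l))\<^sup>2 = (norm (x - (l + scale ?c v)))\<^sup>2 + (norm (scale ?c v))\<^sup>2"
      by (simp add: diff_diff_eq)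
    moreover have "D \<le> (norm (x - (l + scale ?c v)))\<^sup>2"
      using W lW v by (intro D_le subspace_add subspace_scale)
    ultimately have "(norm (scale ?c v))\<^sup>2 \<le> 0" using lD by linarith
    then show ?thesis using False by (simp add: norm_scale)
  qed simp
  with lW show ?thesis by (rule that)
qed

definition orthogonal_projection :: "'a set \<Rightarrow> 'a \<Rightarrow> 'a" where
  "orthogonal_projection W x = (SOME w. w \<in> W \<and> (\<forall>v\<in>W. ip (x - w) v = 0))"

context
  fixes W assumes W: "subspace W" and cl: "closed W"
begin

lemma orthogonal_projection_in: "orthogonal_projection W x \<in> W"
  and orthogonal_projection_orthogonal: "v \<in> W \<Longrightarrow> ip (x - orthogonal_projection W x) v = 0"
proof -
  have "\<exists>w. w \<in> W \<and> (\<forall>v\<in>W. ip (x - w) v = 0)"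
    using exists_orthogonal_projection[OF W cl] by metis
  then have "orthogonal_projection W x \<in> W \<and> (\<forall>v\<in>W. ip (x - orthogonal_projection W x) v = 0)"
    unfolding orthogonal_projection_def by (rule someI_ex)
  then show "orthogonal_projection W x \<in> W" "v \<in> W \<Longrightarrow> ip (x - orthogonal_projection W x) v = 0"
    by blast+
qed

lemma orthogonal_projection_unique:
  assumes w: "w \<in> W" "\<And>v. v \<in> W \<Longrightarrow> ip (x - w) v = 0"
  shows "orthogonal_projection W x = w"
proof -
  let ?d = "orthogonal_projection W x - w"
  have d: "?d \<in> W" using orthogonal_projection_in w(1) by (intro subspace_diff[OF W])
  have "ip (x - w) ?d - ip (x - orthogonal_projection W x) ?d = 0"
    using w(2) orthogonal_projection_orthogonal d by simp
  then have "ip ?d ?d = 0" by (simp add: ip_diff_left)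
  then show ?thesis by (simp add: ip_self)
qed

lemma orthogonal_projection_id: "w \<in> W \<Longrightarrow> orthogonal_projection W w = w"
  by (rule orthogonal_projection_unique) auto

lemma orthogonal_projection_eq_0_iff:
  "orthogonal_projection W x = 0 \<longleftrightarrow> (\<forall>v\<in>W. ip x v = 0)"
  using orthogonal_projection_orthogonal[of _ x] orthogonal_projection_unique[of 0 x]
    subspace_0[OF W] by auto

lemma orthogonal_projection_add:
  "orthogonal_projection W (x + y) = orthogonal_projection W x + orthogonal_projection W y"
proof (rule orthogonal_projection_unique)
  show "orthogonal_projection W x + orthogonal_projection W y \<in> W"
    by (intro subspace_add[OF W] orthogonal_projection_in)
  fix v assume "v \<in> W"
  moreover have "x + y - (orthogonal_projection W x + orthogonal_projection W y)
    = (x - orthogonal_projection W x) + (y - orthogonal_projection W y)" by simp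
  ultimately show "ip (x + y - (orthogonal_projection W x + orthogonal_projection W y)) v = 0"
    by (simp only: ip_add_left orthogonal_projection_orthogonal add_0)
qed

lemma orthogonal_projection_scale:
  "orthogonal_projection W (scale k x) = scale k (orthogonal_projection W x)"
proof (rule orthogonal_projection_unique)
  show "scale k (orthogonal_projection W x) \<in> W"
    by (intro subspace_scale[OF W] orthogonal_projection_in)
  fix v assume "v \<in> W"
  then show "ip (scale k x - scale k (orthogonal_projection W x)) v = 0"
    by (simp only: scale_right_diff_distrib[symmetric] ip_scale_left orthogonal_projection_orthogonal mult_zero_right)
qed

lemma norm_orthogonal_projection_le: "norm (orthogonal_projection W x) \<le> norm x"
proof -
  have "ip (x - orthogonal_projection W x) (orthogonal_projection W x) = 0"
    by (intro orthogonal_projection_orthogonal orthogonal_projection_in)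
  from pythagoras[OF this] have "(norm (orthogonal_projection W x))\<^sup>2 \<le> (norm x)\<^sup>2" by simp
  then show ?thesis by (rule power2_le_imp_le) simp
qed

lemma bounded_linear_orthogonal_projection: "bounded_linear (orthogonal_projection W)"
  using orthogonal_projection_scale[of "of_real _"] norm_orthogonal_projection_le
  by (intro bounded_linear_intro[where K = 1]) (auto simp: orthogonal_projection_add scale_of_real)

end

text \<open>Let \<open>u\<close> be the component of \<open>e\<close> orthogonal to \<open>W\<close>. Then \<open>x\<close> is in the span if and only if it is the
  sum of its projections to \<open>W\<close> and to the line of \<open>u\<close>, both of which are continuous.\<close>

lemma closed_span_insert:
  assumes W: "subspace W" "closed W"
  shows "closed (span (insert e W))"
proof -
  define P where "P = orthogonal_projection W"
  define u where "u = e - P e"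
  have PW: "P x \<in> W" for x unfolding P_def by (rule orthogonal_projection_in[OF W])
  have Padd: "P (x + y) = P x + P y" and Pscale: "P (scale k x) = scale k (P x)"
    and Pid: "w \<in> W \<Longrightarrow> P w = w" for x y k w
    unfolding P_def using orthogonal_projection_add[OF W] orthogonal_projection_scale[OF W]
      orthogonal_projection_id[OF W] by auto
  have span: "x \<in> span (insert e W) \<longleftrightarrow> (\<exists>k. x - scale k e \<in> W)" for x
    using span_breakdown_eq[of x e W] span_eq_iff[THEN iffD2, OF W(1)] by simp
  show ?thesis
  proof (cases "u = 0")
    case True
    then have "e \<in> W" using PW[of e] by (simp add: u_def)
    then have "span (insert e W) = W" using span_eq_iff[THEN iffD2, OF W(1)] by (simp add: insert_absorb)
    then show ?thesis using W(2) by simp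
  next
    case False
    define c where "c x = ip x u / of_real ((norm u)\<^sup>2)" for x
    have orth: "ip w u = 0" if "w \<in> W" for w
      using orthogonal_projection_orthogonal[OF W that, of e] ip_zero_commute by (simp add: u_def P_def)
    have "bounded_linear (\<lambda>x. scale (c x) u)"
    proof (rule bounded_linear_intro)
      show "scale (c (x + y)) u = scale (c x) u + scale (c y) u" for x y
        by (simp add: c_def ip_add_left add_divide_distrib scale_left_distrib)
      show "scale (c (r *\<^sub>R x)) u = r *\<^sub>R scale (c x) u" for r x
        by (simp add: c_def scale_of_real[symmetric] ip_scale_left)
      show "norm (scale (c x) u) \<le> norm x * 1" for x
        using cauchy_schwarz[of x u] False
        by (simp add: c_def norm_scale norm_divide del: of_real_power) (simp add: power2_eq_square divide_simps)
    qed
    moreover have "bounded_linear P"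
      unfolding P_def by (rule bounded_linear_orthogonal_projection[OF W])
    ultimately have "bounded_linear (\<lambda>x. x - P x - scale (c x) u)"
      by (intro bounded_linear_sub bounded_linear_ident)
    then have closed: "closed {x. x - P x - scale (c x) u = 0}"
      by (intro closed_Collect_eq linear_continuous_on continuous_on_const)
    have "x \<in> span (insert e W) \<longleftrightarrow> x - P x - scale (c x) u = 0" for x
    proof
      assume "x \<in> span (insert e W)"
      then obtain k where k: "x - scale k e \<in> W" by (auto simp: span)
      define w where "w = x - scale k e + scale k (P e)"
      have w: "w \<in> W" unfolding w_def using k W PW by (intro subspace_add subspace_scale)
      have x: "x = w + scale k u" by (simp add: w_def u_def scale_right_diff_distrib)
      have "P u = 0" using Padd[of e "- P e"] Pscale[of "-1" "P e"] Pid[OF PW[of e]]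
        by (simp add: u_def)
      then have "P x = w" using Pid[OF w] by (simp add: x Padd Pscale)
      moreover have "c x = k" using False orth[OF w] by (simp add: x c_def ip_add_left ip_scale_left ip_self)
      ultimately show "x - P x - scale (c x) u = 0" by (simp add: x)
    next
      assume "x - P x - scale (c x) u = 0"
      then have "x - scale (c x) e = P x - scale (c x) (P e)"
        by (simp add: u_def scale_right_diff_distrib algebra_simps)
      moreover have "P x - scale (c x) (P e) \<in> W"
        using W PW by (intro subspace_diff subspace_scale)
      ultimately show "x \<in> span (insert e W)" unfolding span by metis
    qed
    then have "span (insert e W) = {x. x - P x - scale (c x) u = 0}" by blast
    then show ?thesis using closed by simp
  qed
qed

lemma closed_span_finite: "finite F \<Longrightarrow> closed (span F)"
proof (induction F rule: finite_induct)
  case (insert x F)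
  have "span (insert x F) = span (insert x (span F))"
    by (metis span_insert span_span)
  then show ?case using closed_span_insert[of "span F" x] insert.IH by simp
qed simp

end

section \<open>The open mapping theorem for closed subspaces\<close>

text \<open>The category argument in the open mapping theorem. The closed subspace \<open>f ` S\<close> is the union
  of the closures of the images of balls, so one of them contains a relative ball. Taking
  differences moves this ball to the origin, and scaling gives approximate preimages whose norm
  is controlled by a constant.\<close>

lemma open_mapping_closure:
  fixes f :: "'a::real_normed_vector \<Rightarrow> 'b::banach"
  assumes f: "bounded_linear f" and S: "subspace S" and cl: "closed (f ` S)"
  obtains C where "C > 0"
    "\<And>y \<delta>. y \<in> f ` S \<Longrightarrow> \<delta> > 0 \<Longrightarrow> \<exists>x\<in>S. norm x \<le> C * norm y \<and> norm (y - f x) < \<delta>"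
proof -
  interpret f: bounded_linear f by fact
  define Y where "Y = f ` S"
  have subY: "subspace Y" unfolding Y_def using f.linear S by (rule real_vector.linear_subspace_image)
  define A where "A n = closure (f ` (S \<inter> cball 0 (real n)))" for n :: nat
  have AY: "A n \<subseteq> Y" for n
    unfolding A_def Y_def by (rule closure_minimal[OF _ cl]) auto
  have "Y \<subseteq> \<Union>(range A)"
  proof
    fix y assume "y \<in> Y"
    then obtain x where x: "x \<in> S" "y = f x" by (auto simp: Y_def)
    obtain n where "norm x \<le> real n" using real_arch_simple by blast
    then have "y \<in> A n" unfolding A_def using x by (intro closure_subset[THEN subsetD]) auto
    then show "y \<in> \<Union>(range A)" by blast
  qed
  have "\<exists>n. top_of_set Y interior_of A n \<noteq> {}"
  proof (rule ccontr)
    assume none: "\<not> ?thesis"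
    have "top_of_set Y interior_of \<Union>(range A) = {}"
    proof (rule Baire_category_alt)
      show "completely_metrizable_space (top_of_set Y) \<or> locally_compact_space (top_of_set Y) \<and> regular_space (top_of_set Y)"
      proof (rule disjI1, rule completely_metrizable_space_closedin[OF completely_metrizable_space_euclidean])
        show "closedin euclidean Y" using cl by (simp only: Y_def closed_closedin)
      qed
      fix T assume "T \<in> range A"
      then obtain n where "T = A n" by blast
      then show "closedin (top_of_set Y) T \<and> top_of_set Y interior_of T = {}"
        using none closed_subset[OF AY[of n]] closed_closure[of "f ` (S \<inter> cball 0 (real n))"]
        by (simp add: A_def[symmetric])
    qed auto
    moreover have "\<Union>(range A) = Y" using \<open>Y \<subseteq> \<Union>(range A)\<close> AY by blast
    moreover have "top_of_set Y interior_of Y = Y"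
      by (rule interior_of_openin) (rule openin_subtopology_self)
    moreover have "0 \<in> Y" using subY by (rule real_vector.subspace_0)
    ultimately show False by auto
  qed
  then obtain n y0 where "y0 \<in> top_of_set Y interior_of A n" by blast
  then obtain U where U: "openin (top_of_set Y) U" "y0 \<in> U" "U \<subseteq> A n"
    by (auto simp: interior_of_def)
  then obtain r where r: "r > 0" "ball y0 r \<inter> Y \<subseteq> A n" and y0: "y0 \<in> Y"
    unfolding openin_contains_ball by blast
  have approx0: "\<exists>x\<in>S. norm x \<le> n \<and> norm (y - f x) < \<delta>" if "y \<in> A n" "\<delta> > 0" for y \<delta>
  proof -
    have "\<exists>x\<in>S \<inter> cball 0 (real n). dist y (f x) < \<delta>"
      using closure_approachableD[of y "f ` (S \<inter> cball 0 (real n))" \<delta>] that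
      by (simp add: A_def)
    then show ?thesis by (auto simp: dist_norm)
  qed
  have approx1: "\<exists>x\<in>S. norm x \<le> 2 * n \<and> norm (y - f x) < \<delta>"
    if y: "y \<in> Y" "norm y < r" and "\<delta> > 0" for y \<delta>
  proof -
    have "y0 + y \<in> A n" "y0 \<in> A n"
      using r y y0 real_vector.subspace_add[OF subY] by (auto simp: dist_norm)
    then obtain x1 x2 where x: "x1 \<in> S" "norm x1 \<le> n" "norm ((y0 + y) - f x1) < \<delta> / 2"
      "x2 \<in> S" "norm x2 \<le> n" "norm (y0 - f x2) < \<delta> / 2"
      using approx0[of _ "\<delta> / 2"] \<open>\<delta> > 0\<close> by (metis half_gt_zero)
    have "norm (x1 - x2) \<le> 2 * n" using norm_triangle_ineq4[of x1 x2] x by simp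
    moreover have "y - f (x1 - x2) = ((y0 + y) - f x1) - (y0 - f x2)" by (simp add: f.diff)
    then have "norm (y - f (x1 - x2)) \<le> norm ((y0 + y) - f x1) + norm (y0 - f x2)"
      using norm_triangle_ineq4[of "(y0 + y) - f x1" "y0 - f x2"] by (simp only:)
    then have "norm (y - f (x1 - x2)) < \<delta>" using x by simp
    moreover have "x1 - x2 \<in> S" using x real_vector.subspace_diff[OF S] by blast
    ultimately show ?thesis by blast
  qed
  show ?thesis
  proof
    show "4 * (real n + 1) / r > 0" using r by simp
    fix y :: 'b and \<delta> :: real assume y: "y \<in> f ` S" and "\<delta> > 0"
    show "\<exists>x\<in>S. norm x \<le> 4 * (real n + 1) / r * norm y \<and> norm (y - f x) < \<delta>"
    proof (cases "y = 0")
      case True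
      then show ?thesis
        using \<open>\<delta> > 0\<close> real_vector.subspace_0[OF S] by (intro bexI[of _ 0]) (auto simp: f.zero)
    next
      case False
      define t where "t = r / (2 * norm y)"
      have t: "t > 0" using r False by (simp add: t_def)
      have "norm (t *\<^sub>R y) = r / 2" using False r(1) by (simp add: t_def)
      then have "norm (t *\<^sub>R y) < r" using r by simp
      moreover have "t *\<^sub>R y \<in> Y" using y subY by (auto simp: Y_def intro: real_vector.subspace_scale)
      ultimately obtain x where x: "x \<in> S" "norm x \<le> 2 * n" "norm (t *\<^sub>R y - f x) < t * \<delta>"
        using approx1[of "t *\<^sub>R y" "t * \<delta>"] t \<open>\<delta> > 0\<close> by auto
      have "norm (x /\<^sub>R t) \<le> (2 * n) / t"
        using x(2) t by (simp add: divide_simps)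
      also have "\<dots> = 4 * real n / r * norm y" using r False by (simp add: t_def)
      also have "\<dots> \<le> 4 * (real n + 1) / r * norm y"
        using r by (intro mult_right_mono divide_right_mono) auto
      finally have "norm (x /\<^sub>R t) \<le> 4 * (real n + 1) / r * norm y" .
      moreover have "y - f (x /\<^sub>R t) = (t *\<^sub>R y - f x) /\<^sub>R t"
        using t by (simp add: f.scaleR scaleR_right_diff_distrib)
      then have "norm (y - f (x /\<^sub>R t)) < \<delta>"
        using x(3) t by (simp add: divide_simps mult.commute)
      moreover have "x /\<^sub>R t \<in> S" using x S by (auto intro: real_vector.subspace_scale)
      ultimately show ?thesis by blast
    qed
  qed
qed

text \<open>The open mapping theorem for closed subspaces: the error of an approximate preimage is
  approximated again, at half the size, and the resulting series of corrections converges in \<open>S\<close>.\<close>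

lemma open_mapping_bounded_preimages:
  fixes f :: "'a::banach \<Rightarrow> 'b::banach"
  assumes f: "bounded_linear f" and S: "subspace S" "closed S" and cl: "closed (f ` S)"
  obtains K where "\<And>y. y \<in> f ` S \<Longrightarrow> \<exists>x\<in>S. f x = y \<and> norm x \<le> K * norm y"
proof -
  interpret f: bounded_linear f by fact
  obtain C where C: "C > 0"
    "\<And>y \<delta>. y \<in> f ` S \<Longrightarrow> \<delta> > 0 \<Longrightarrow> \<exists>x\<in>S. norm x \<le> C * norm y \<and> norm (y - f x) < \<delta>"
    using open_mapping_closure[OF f S(1) cl] by blast
  have "\<exists>x\<in>S. f x = y \<and> norm x \<le> (2 * C) * norm y" if y: "y \<in> f ` S" for y
  proof (cases "y = 0")
    case True
    then show ?thesis using real_vector.subspace_0[OF S(1)] by (intro bexI[of _ 0]) (auto simp: f.zero)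
  next
    case False
    obtain g where g: "\<And>z \<delta>. z \<in> f ` S \<Longrightarrow> \<delta> > 0 \<Longrightarrow> g z \<delta> \<in> S \<and> norm (g z \<delta>) \<le> C * norm z \<and> norm (z - f (g z \<delta>)) < \<delta>"
      using C(2) by metis
    \<comment> \<open>The tolerances halve in each step, hence the corrections \<open>x k\<close> are dominated by a
      geometric series with sum \<open>2 * C * norm y\<close>.\<close>
    define d where "d k = norm y / 2 ^ Suc k" for k :: nat
    have d: "d k > 0" for k using False by (simp add: d_def)
    define z where "z = rec_nat y (\<lambda>k z. z - f (g z (d k)))"
    define x where "x k = g (z k) (d k)" for k
    have z0: "z 0 = y" and zS: "z (Suc k) = z k - f (x k)" for k by (simp_all add: z_def x_def)
    have z: "z k \<in> f ` S \<and> norm (z k) \<le> norm y / 2 ^ k" for k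
    proof (induction k)
      case 0
      then show ?case using y by (simp add: z0)
    next
      case (Suc k)
      have "x k \<in> S" "norm (z (Suc k)) < d k"
        using g[of "z k" "d k"] Suc d by (auto simp: zS x_def)
      moreover obtain s where "s \<in> S" "z k = f s" using Suc by auto
      ultimately have "z (Suc k) = f (s - x k)" "s - x k \<in> S"
        using real_vector.subspace_diff[OF S(1)] by (auto simp: zS f.diff)
      then show ?case using \<open>norm (z (Suc k)) < d k\<close> by (auto simp: d_def)
    qed
    have x: "x k \<in> S" "norm (x k) \<le> C * norm y * (1 / 2) ^ k" for k
    proof -
      show "x k \<in> S" using g[of "z k" "d k"] z d by (auto simp: x_def)
      have "norm (x k) \<le> C * norm (z k)" using g[of "z k" "d k"] z d by (auto simp: x_def)
      also have "\<dots> \<le> C * (norm y / 2 ^ k)" using z C by (intro mult_left_mono) auto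
      finally show "norm (x k) \<le> C * norm y * (1 / 2) ^ k" by (simp add: power_divide)
    qed
    have geo: "(\<lambda>k. C * norm y * (1 / 2) ^ k) sums (C * norm y * 2)"
      using sums_mult[OF geometric_sums[of "1 / 2 :: real"], of "C * norm y"] by simp
    have sumn: "summable (\<lambda>k. norm (x k))"
      by (rule summable_comparison_test[OF _ sums_summable[OF geo]]) (use x in auto)
    then have sumx: "summable x" by (rule summable_norm_cancel)
    have "norm (suminf x) \<le> (\<Sum>k. norm (x k))" by (rule summable_norm[OF sumn])
    also have "\<dots> \<le> C * norm y * 2"
      using suminf_le[OF x(2) sumn sums_summable[OF geo]] sums_unique[OF geo] by simp
    finally have "norm (suminf x) \<le> 2 * C * norm y" by simp
    moreover have "suminf x \<in> S"
    proof (rule closed_sequentially[OF S(2)])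
      show "(\<Sum>k<n. x k) \<in> S" for n using x by (intro real_vector.subspace_sum[OF S(1)]) auto
      show "(\<lambda>n. \<Sum>k<n. x k) \<longlonglongrightarrow> suminf x" by (rule summable_LIMSEQ[OF sumx])
    qed
    moreover have "f (suminf x) = y"
    proof -
      have "z n = y - f (\<Sum>k<n. x k)" for n
        by (induction n) (simp_all add: z0 zS f.zero f.add)
      moreover have "(\<lambda>n. y - f (\<Sum>k<n. x k)) \<longlonglongrightarrow> y - f (suminf x)"
        by (intro tendsto_intros f.tendsto summable_LIMSEQ[OF sumx])
      moreover have "z \<longlonglongrightarrow> 0"
      proof (rule Lim_null_comparison)
        show "\<forall>\<^sub>F n in sequentially. norm (z n) \<le> norm y * (1 / 2) ^ n"
          using z by (simp add: power_divide)
        show "(\<lambda>n. norm y * (1 / 2) ^ n) \<longlonglongrightarrow> 0"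
          by (intro tendsto_mult_right_zero LIMSEQ_power_zero) simp
      qed
      ultimately have "y - f (suminf x) = 0"
        using LIMSEQ_unique by (metis (no_types, lifting) ext)
      then show ?thesis by simp
    qed
    ultimately show ?thesis by blast
  qed
  then show ?thesis using that by blast
qed

section \<open>Stability of outer inverses\<close>

lemma bounded_operators_add:
  assumes "vector_space sc1" "vector_space sc2" "S \<in> bounded_operators sc1 sc2" "T \<in> bounded_operators sc1 sc2"
  shows "S + T \<in> bounded_operators sc1 sc2"
proof -
  interpret v2: vector_space sc2 by fact
  show ?thesis using assms(3,4) by (simp add: bounded_operators_def blinfun.add_left v2.scale_right_distrib)
qed

lemma bounded_operators_diff:
  assumes "vector_space sc1" "vector_space sc2" "S \<in> bounded_operators sc1 sc2" "T \<in> bounded_operators sc1 sc2"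
  shows "S - T \<in> bounded_operators sc1 sc2"
proof -
  interpret v2: vector_space sc2 by fact
  show ?thesis using assms(3,4) by (simp add: bounded_operators_def blinfun.diff_left v2.scale_right_diff_distrib)
qed

lemma bounded_operators_compose:
  "S \<in> bounded_operators sc2 sc3 \<Longrightarrow> T \<in> bounded_operators sc1 sc2 \<Longrightarrow> S o\<^sub>L T \<in> bounded_operators sc1 sc3"
  by (simp add: bounded_operators_def)

text \<open>The solution \<open>x\<close> of \<open>x - A x = y\<close> is the fixed point of the contraction \<open>x \<mapsto> y + A x\<close>;
  its uniqueness makes it depend linearly on \<open>y\<close>, over all scalars for which \<open>A\<close> is linear.\<close>

lemma exists_inverse_one_minus_contraction:
  fixes sc :: "'k::field \<Rightarrow> 'a::banach \<Rightarrow> 'a" and A :: "'a \<Rightarrow>\<^sub>L 'a"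
  assumes "vector_space sc" and A: "A \<in> bounded_operators sc sc" and small: "norm A \<le> 1 / 2"
  obtains J where "J \<in> bounded_operators sc sc" "\<And>x. blinfun_apply J (x - A x) = x"
    "\<And>x. blinfun_apply J x - A (J x) = x" "\<And>x. norm (blinfun_apply J x) \<le> 2 * norm x"
proof -
  interpret vector_space sc by fact
  have half: "norm (A x) \<le> norm x / 2" for x
    using order_trans[OF norm_blinfun[of A x] mult_right_mono[OF small norm_ge_zero[of x]]] by simp
  have "\<exists>x. x - A x = y" for y
  proof -
    have "\<exists>!x. y + A x = x"
    proof (rule banach_fix_type)
      show "\<forall>x x'. dist (y + A x) (y + A x') \<le> 1 / 2 * dist x x'"
        using half[of "_ - _"] by (simp add: dist_norm blinfun.diff_right[symmetric])
    qed auto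
    then obtain x where "y + A x = x" by blast
    then have "x - A x = y" by (simp add: algebra_simps)
    then show ?thesis by blast
  qed
  then obtain j where j: "\<And>y. j y - A (j y) = y" by metis
  have inj: "x = x'" if "x - A x = x' - A x'" for x x'
  proof -
    have "x - x' = A (x - x')" using that by (simp add: blinfun.diff_right algebra_simps)
    then have "norm (x - x') \<le> norm (x - x') / 2" using half[of "x - x'"] by simp
    then show ?thesis by simp
  qed
  have bound: "norm (j y) \<le> 2 * norm y" for y
  proof -
    have "j y = y + A (j y)" using j[of y] by (simp add: algebra_simps)
    then have "norm (j y) \<le> norm y + norm (A (j y))" using norm_triangle_ineq by metis
    then show ?thesis using half[of "j y"] by simp
  qed
  have lin: "bounded_linear j"
  proof (rule bounded_linear_intro)
    show "j (x + y) = j x + j y" for x y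
      by (rule inj) (simp add: j blinfun.add_right, simp add: add_diff_add j)
    show "j (r *\<^sub>R x) = r *\<^sub>R j x" for r x
      by (rule inj) (simp add: j blinfun.scaleR_right scaleR_right_diff_distrib[symmetric])
    show "norm (j x) \<le> norm x * 2" for x using bound[of x] by simp
  qed
  have "j (sc k x) = sc k (j x)" for k x
    by (rule inj) (use A in \<open>simp add: j bounded_operators_def scale_right_diff_distrib[symmetric]\<close>)
  then show ?thesis
    using that[of "Blinfun j"] lin j bound inj[OF j]
    by (simp add: bounded_linear_Blinfun_apply bounded_operators_def)
qed

text \<open>The new outer inverse is \<open>V1 = (1 - V (U - U1))\<^sup>-\<^sup>1 V\<close>. It has the null space of \<open>V\<close>, since
  it arises from \<open>V\<close> by composition with an invertible operator, and the range of \<open>V\<close>, since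
  the operator \<open>1 - V (U - U1)\<close> preserves that range in both directions. On this range \<open>V U\<close> is the
  identity, so that \<open>V U1 = 1 - V (U - U1)\<close> there and \<open>V1 U1 V1 = V1\<close> follows.\<close>

lemma outer_inverse_perturbation:
  fixes sc1 :: "'k::field \<Rightarrow> 'a::banach \<Rightarrow> 'a" and sc2 :: "'k \<Rightarrow> 'b::banach \<Rightarrow> 'b"
    and U U1 :: "'a \<Rightarrow>\<^sub>L 'b" and V :: "'b \<Rightarrow>\<^sub>L 'a"
  assumes vs: "vector_space sc1" "vector_space sc2"
    and U: "U \<in> bounded_operators sc1 sc2" and U1: "U1 \<in> bounded_operators sc1 sc2"
    and V: "V \<in> bounded_operators sc2 sc1"
    and VUV: "\<And>y. V (U (V y)) = V y" and small: "norm V * norm (U - U1) \<le> 1 / 2"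
  obtains V1 where "V1 \<in> bounded_operators sc2 sc1" "\<And>y. V1 (U1 (V1 y)) = V1 y"
    "{y. blinfun_apply V1 y = 0} = {y. V y = 0}" "range (blinfun_apply V1) = range V"
    "norm (V - V1) \<le> 2 * (norm V)\<^sup>2 * norm (U - U1)"
proof -
  define A where "A = V o\<^sub>L (U - U1)"
  have Ax: "A x = V (U x) - V (U1 x)" for x
    by (simp add: A_def blinfun.diff_left blinfun.diff_right)
  have "A \<in> bounded_operators sc1 sc1"
    unfolding A_def by (intro bounded_operators_compose[OF V] bounded_operators_diff vs U U1)
  moreover have "norm A \<le> 1 / 2"
    using order_trans[OF norm_blinfun_compose small] by (simp add: A_def)
  ultimately obtain J where J: "J \<in> bounded_operators sc1 sc1" and J1: "\<And>x. blinfun_apply J (x - A x) = x"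
    and J2: "\<And>x. blinfun_apply J x - A (J x) = x" and J3: "\<And>x. norm (blinfun_apply J x) \<le> 2 * norm x"
    using exists_inverse_one_minus_contraction[OF vs(1)] by blast
  define V1 where "V1 = J o\<^sub>L V"
  have V1: "V1 y = J (V y)" for y by (simp add: V1_def)
  have in_range: "V1 y = V (y + (U (V1 y) - U1 (V1 y)))" for y
    using J2[of "V y"] by (simp add: V1 Ax blinfun.add_right blinfun.diff_right algebra_simps)
  show ?thesis
  proof
    show "V1 \<in> bounded_operators sc2 sc1"
      unfolding V1_def by (rule bounded_operators_compose[OF J V])
    show "V1 (U1 (V1 y)) = V1 y" for y
    proof -
      have "V (U (V1 y)) = V1 y" by (subst in_range, subst VUV, rule in_range[symmetric])
      then have "V (U1 (V1 y)) = V1 y - A (V1 y)" by (simp add: Ax)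
      then show ?thesis by (simp add: V1[of "U1 _"] J1)
    qed
    have "V y = 0" if "V1 y = 0" for y
      using J2[of "V y"] that by (simp add: V1 blinfun.zero_right)
    then show "{y. blinfun_apply V1 y = 0} = {y. V y = 0}"
      by (auto simp: V1 blinfun.zero_right)
    have "V y = V1 (y - (U (V y) - U1 (V y)))" for y
      using J1[of "V y"] by (simp add: V1 Ax blinfun.diff_right)
    then show "range (blinfun_apply V1) = range V"
      using in_range by (metis (no_types, lifting) image_subsetI rangeI subset_antisym)
    show "norm (V - V1) \<le> 2 * (norm V)\<^sup>2 * norm (U - U1)"
    proof (rule norm_blinfun_bound)
      fix y
      have "V y - V1 y = - J (A (V y))"
        using J1[of "V y"] by (simp add: V1 blinfun.diff_right algebra_simps)
      then have "norm ((V - V1) y) \<le> 2 * norm (A (V y))"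
        using J3[of "A (V y)"] by (simp add: blinfun.diff_left)
      also have "norm (A (V y)) \<le> norm A * (norm V * norm y)"
        by (rule order_trans[OF norm_blinfun]) (intro mult_left_mono norm_blinfun norm_ge_zero)
      also have "\<dots> \<le> (norm V * norm (U - U1)) * (norm V * norm y)"
        unfolding A_def by (intro mult_right_mono norm_blinfun_compose) simp
      finally show "norm ((V - V1) y) \<le> 2 * (norm V)\<^sup>2 * norm (U - U1) * norm y"
        by (simp add: power2_eq_square mult_ac)
    qed simp
  qed
qed

section \<open>Outer inverses for a Fredholm pair\<close>

text \<open>Let \<open>M\<close> be the orthogonal complement of \<open>ker T\<close> in \<open>ker (S T)\<close>. Then \<open>T\<close> maps \<open>M\<close> bijectively
  onto \<open>Z = ker S \<inter> range T\<close>, and \<open>T'\<close> is the inverse of this bijection, composed with the orthogonal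
  projection onto \<open>Z\<close>. This requires that \<open>Z\<close> is closed and that the inverse is bounded,
  which hold because \<open>Z\<close> has finite codimension in the closed space \<open>ker S\<close>: \<open>T\<close> on \<open>M\<close>, together
  with the inclusion of a finite-dimensional complement of \<open>Z\<close>, is a bijection onto \<open>ker S\<close> to which
  the open mapping theorem applies.

  The choice of orthogonal complements is recorded in the conclusion, because it makes the
  outer inverses of \<open>S\<close> and of \<open>T\<close> annihilate each other.\<close>

lemma exists_bounded_outer_inverse:
  fixes sc1 :: "'k::real_or_complex \<Rightarrow> 'a::banach \<Rightarrow> 'a" and sc2 :: "'k \<Rightarrow> 'b::banach \<Rightarrow> 'b"
    and ip1 :: "'a \<Rightarrow> 'a \<Rightarrow> 'k" and ip2 :: "'b \<Rightarrow> 'b \<Rightarrow> 'k"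
    and S :: "'a \<Rightarrow>\<^sub>L 'b" and T :: "'b \<Rightarrow>\<^sub>L 'a"
  assumes h1: "hilbert_space sc1 ip1" and h2: "hilbert_space sc2 ip2"
    and S: "S \<in> bounded_operators sc1 sc2" and T: "T \<in> bounded_operators sc2 sc1"
    and fin: "linear_space.almost_in sc1 {x. S x = 0} (range T)"
  obtains T' :: "'a \<Rightarrow>\<^sub>L 'b" where "T' \<in> bounded_operators sc1 sc2" "\<And>x. T' (T (T' x)) = T' x"
    "\<And>x. S (T (T' x)) = 0" "\<And>x y. T y = 0 \<Longrightarrow> ip2 (T' x) y = 0"
    "\<And>y. S (T y) = 0 \<Longrightarrow> T (T' (T y)) = T y"
    "\<And>x. (\<And>z. S z = 0 \<Longrightarrow> ip1 x z = 0) \<Longrightarrow> T' x = 0"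
proof -
  interpret h1: hilbert_space sc1 ip1 by fact
  interpret h2: hilbert_space sc2 ip2 by fact
  interpret fwd: linear_space_pair sc1 sc2 ..
  interpret bwd: linear_space_pair sc2 sc1 ..
  have linS: "Vector_Spaces.linear sc1 sc2 (blinfun_apply S)"
    by (rule linear_of_bounded_operators[OF h1.vector_space_axioms h2.vector_space_axioms S])
  have linT: "Vector_Spaces.linear sc2 sc1 (blinfun_apply T)"
    by (rule linear_of_bounded_operators[OF h2.vector_space_axioms h1.vector_space_axioms T])
  have T_scale: "T (sc2 k y) = sc1 k (T y)" and S_scale: "S (sc1 k x) = sc2 k (S x)" for k x y
    using S T by (auto simp: bounded_operators_def)
  define N where "N = {y. T y = 0}"
  have N: "h2.subspace N" "closed N"
    unfolding N_def using bwd.linear_subspaces(1)[OF linT]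
    by (auto intro!: closed_Collect_eq continuous_intros)
  define P where "P = h2.orthogonal_projection N"
  have P_in: "T (P y) = 0" for y
    using h2.orthogonal_projection_in[OF N, of y] by (simp add: P_def N_def)
  have P_lin: "bounded_linear P" unfolding P_def by (rule h2.bounded_linear_orthogonal_projection[OF N])
  interpret P: bounded_linear P by (rule P_lin)
  have P_id: "P y = y" if "T y = 0" for y
    unfolding P_def by (rule h2.orthogonal_projection_id[OF N]) (use that in \<open>simp add: N_def\<close>)
  have P_scale: "P (sc2 k y) = sc2 k (P y)" for k y
    unfolding P_def by (rule h2.orthogonal_projection_scale[OF N])
  define M where "M = {y. S (T y) = 0 \<and> P y = 0}"
  have M: "h2.subspace M" "closed M"
  proof -
    show "h2.subspace M"
      by (rule h2.subspaceI)
        (auto simp: M_def P.zero P.add P_scale blinfun.zero_right blinfun.add_right T_scale S_scale)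
    have "M = {y. S (T y) = 0} \<inter> {y. P y = 0}" by (auto simp: M_def)
    then show "closed M"
      using linear_continuous_on[OF P_lin]
      by (auto intro!: closed_Int closed_Collect_eq continuous_intros)
  qed
  have T_inj_M: "y = y'" if "y \<in> M" "y' \<in> M" "T y = T y'" for y y'
  proof -
    have "P (y - y') = y - y'" by (rule P_id) (use that in \<open>simp add: blinfun.diff_right\<close>)
    then show ?thesis using that by (simp add: M_def P.diff)
  qed
  define Z where "Z = {x. S x = 0} \<inter> range T"
  have Z_eq: "Z = T ` M"
  proof
    show "Z \<subseteq> T ` M"
    proof
      fix x assume "x \<in> Z"
      then obtain y where y: "x = T y" "S (T y) = 0" by (auto simp: Z_def)
      have "y - P y \<in> M" "T (y - P y) = x"
        using y P_id[OF P_in] by (auto simp: M_def P.diff blinfun.diff_right P_in blinfun.zero_right)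
      then show "x \<in> T ` M" by blast
    qed
  qed (auto simp: Z_def M_def)
  have NS: "h1.subspace {x. S x = 0}" "closed {x. S x = 0}"
    using fwd.linear_subspaces(1)[OF linS] by (auto intro!: closed_Collect_eq continuous_intros)
  have subZ: "h1.subspace Z"
    unfolding Z_def using NS(1) bwd.linear_subspaces(2)[OF linT] by (rule h1.subspace_inter)
  have "h1.almost_in {x. S x = 0} Z"
    unfolding Z_def by (rule h1.almost_in_inter[OF NS(1) bwd.linear_subspaces(2)[OF linT] fin])
  then obtain B where B: "h1.mod_basis {x. S x = 0} Z B" by (rule h1.mod_basis_exists[OF subZ])
  then have finB: "finite B" "B \<subseteq> {x. S x = 0}" "{x. S x = 0} \<subseteq> h1.span (Z \<union> B)"
    by (auto simp: h1.mod_basis_def)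
  have spanB: "h1.span B \<subseteq> {x. S x = 0}" by (rule h1.span_minimal[OF finB(2) NS(1)])
  have ZB: "e = 0" if "e \<in> h1.span B" "e \<in> Z" for e
  proof -
    obtain u where u: "e = (\<Sum>b\<in>B. sc1 (u b) b)"
      using \<open>e \<in> h1.span B\<close> h1.span_finite[OF finB(1)] by auto
    then have "u b = 0" if "b \<in> B" for b
      using h1.mod_basis_independent[OF B, of u] that \<open>e \<in> Z\<close> by simp
    then show ?thesis by (simp add: u)
  qed
  \<comment> \<open>The open mapping theorem for \<open>(y, e) \<mapsto> T y + e\<close> on \<open>M \<times> span B\<close>, which is injective.\<close>
  obtain K where K: "\<And>y. y \<in> M \<Longrightarrow> norm y \<le> K * norm (T y)"
  proof -
    let ?f = "\<lambda>p. T (fst p) + snd p"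
    have lin: "bounded_linear ?f"
      by (intro bounded_linear_add bounded_linear_snd
          bounded_linear_compose[OF blinfun.bounded_linear_right bounded_linear_fst])
    have sub: "subspace (M \<times> h1.span B)"
      using h2.subspace_real[OF M(1)] h1.subspace_real[OF h1.subspace_span]
      by (auto simp: real_vector.subspace_def zero_prod_def)
    have im: "?f ` (M \<times> h1.span B) = {x. S x = 0}"
    proof
      show "?f ` (M \<times> h1.span B) \<subseteq> {x. S x = 0}"
        using spanB by (auto simp: M_def blinfun.add_right)
      show "{x. S x = 0} \<subseteq> ?f ` (M \<times> h1.span B)"
      proof
        fix x assume "x \<in> {x. S x = 0}"
        then obtain z e where "z \<in> Z" "e \<in> h1.span B" "x = z + e"
          using finB(3) h1.in_span_subspace_Un_set[OF subZ, of x B] by blast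
        moreover from this obtain y where "y \<in> M" "z = T y" unfolding Z_eq by blast
        ultimately show "x \<in> ?f ` (M \<times> h1.span B)"
          by (intro image_eqI[of _ _ "(y, e)"]) auto
      qed
    qed
    obtain K where K: "\<And>x. x \<in> {x. S x = 0} \<Longrightarrow>
        \<exists>p\<in>M \<times> h1.span B. ?f p = x \<and> norm p \<le> K * norm x"
      using open_mapping_bounded_preimages[OF lin sub] closed_Times[OF M(2) h1.closed_span_finite[OF finB(1)]]
        NS(2) unfolding im by blast
    have "norm y \<le> K * norm (T y)" if y: "y \<in> M" for y
    proof -
      have "T y \<in> {x. S x = 0}" using y by (simp add: M_def)
      then obtain y' e where p: "y' \<in> M" "e \<in> h1.span B" "T y' + e = T y" "norm (y', e) \<le> K * norm (T y)"
        using K by fastforce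
      have "y - y' \<in> M" using y p(1) by (rule h2.subspace_diff[OF M(1)])
      moreover have "e = T (y - y')" using p(3) by (simp add: blinfun.diff_right algebra_simps)
      ultimately have "e \<in> Z" unfolding Z_eq by blast
      then have "e = 0" using ZB p(2) by blast
      then have "y' = y" using T_inj_M[OF p(1) y] p(3) by simp
      then show ?thesis using p(4) norm_fst_le[of y' e] by simp
    qed
    then show ?thesis by (rule that)
  qed
  have clZ: "closed Z"
  proof -
    have "complete (T ` M)"
    proof (rule complete_isometric_image)
      show "0 < 1 / max K 1" by simp
      show "\<forall>y\<in>M. norm (T y) \<ge> 1 / max K 1 * norm y"
      proof
        fix y assume "y \<in> M"
        then have "norm y \<le> max K 1 * norm (T y)"
          using K by (meson max.cobounded1 mult_right_mono norm_ge_zero order_trans)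
        then show "norm (T y) \<ge> 1 / max K 1 * norm y" by (simp add: divide_simps mult.commute)
      qed
    qed (use M h2.subspace_real blinfun.bounded_linear_right complete_eq_closed in auto)
    then show ?thesis unfolding Z_eq by (rule complete_imp_closed)
  qed
  define Q where "Q = h1.orthogonal_projection Z"
  have Q_lin: "bounded_linear Q" unfolding Q_def by (rule h1.bounded_linear_orthogonal_projection[OF subZ clZ])
  interpret Q: bounded_linear Q by (rule Q_lin)
  have Q_in: "Q x \<in> Z" for x unfolding Q_def by (rule h1.orthogonal_projection_in[OF subZ clZ])
  have Q_id: "x \<in> Z \<Longrightarrow> Q x = x" for x unfolding Q_def by (rule h1.orthogonal_projection_id[OF subZ clZ])
  have Q_le: "norm (Q x) \<le> norm x" for x unfolding Q_def by (rule h1.norm_orthogonal_projection_le[OF subZ clZ])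
  have Q_scale: "Q (sc1 k x) = sc1 k (Q x)" for k x
    unfolding Q_def by (rule h1.orthogonal_projection_scale[OF subZ clZ])
  have "\<exists>y. y \<in> M \<and> T y = Q x" for x using Q_in[of x] unfolding Z_eq by auto
  then obtain g where gM: "\<And>x. g x \<in> M" and Tg: "\<And>x. T (g x) = Q x" by metis
  have g_eq: "g x = y" if "y \<in> M" "T y = Q x" for x y
    by (rule T_inj_M[OF gM that(1)]) (simp add: Tg that)
  have g_lin: "bounded_linear g"
  proof (rule bounded_linear_intro)
    show "g (x + y) = g x + g y" for x y
      by (rule g_eq) (simp_all add: h2.subspace_add[OF M(1)] gM blinfun.add_right Tg Q.add)
    show "g (r *\<^sub>R x) = r *\<^sub>R g x" for r x
      by (rule g_eq) (simp_all add: real_vector.subspace_scale[OF h2.subspace_real[OF M(1)]] gM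
          blinfun.scaleR_right Tg Q.scaleR)
    show "norm (g x) \<le> norm x * max K 0" for x
    proof -
      have "norm (g x) \<le> K * norm (Q x)" using K[OF gM[of x]] by (simp add: Tg)
      also have "\<dots> \<le> max K 0 * norm x" using Q_le[of x] by (intro mult_mono) auto
      finally show ?thesis by (simp add: mult.commute)
    qed
  qed
  have g_scale: "g (sc1 k x) = sc2 k (g x)" for k x
    by (rule g_eq) (simp_all add: h2.subspace_scale[OF M(1)] gM T_scale Tg Q_scale)
  have app: "blinfun_apply (Blinfun g) = g" by (rule bounded_linear_Blinfun_apply[OF g_lin])
  show ?thesis
  proof (rule that[of "Blinfun g"], unfold app)
    show "Blinfun g \<in> bounded_operators sc1 sc2" by (simp add: bounded_operators_def app g_scale)
    show "g (T (g x)) = g x" for x by (rule g_eq[OF gM]) (simp add: Tg Q_id[OF Q_in])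
    show "S (T (g x)) = 0" for x using gM[of x] by (simp add: M_def)
    show "ip2 (g x) y = 0" if "T y = 0" for x y
      using gM[of x] h2.orthogonal_projection_eq_0_iff[OF N, of "g x"] that
      by (simp add: M_def P_def N_def)
    show "T (g (T y)) = T y" if "S (T y) = 0" for y
      unfolding Tg by (rule Q_id) (use that in \<open>simp add: Z_def\<close>)
    show "g x = 0" if "\<And>z. S z = 0 \<Longrightarrow> ip1 x z = 0" for x
    proof (rule g_eq)
      show "0 \<in> M" by (rule h2.subspace_0[OF M(1)])
      have "Q x = 0"
        using h1.orthogonal_projection_eq_0_iff[OF subZ clZ, of x] that by (auto simp: Q_def Z_def)
      then show "T 0 = Q x" by (simp add: blinfun.zero_right)
    qed
  qed
qed

text \<open>Let \<open>S'\<close> and \<open>T'\<close> be the outer inverses of \<open>S\<close> and \<open>T\<close> built from orthogonal complements, so that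
  \<open>S' T' = 0\<close> and \<open>T' S' = 0\<close>. Then \<open>V = S' + T T' T\<close> is an outer inverse of \<open>S + T'\<close>. It inverts
  \<open>S + T'\<close> on the range of \<open>S S' + T' T\<close>, and this range has finite codimension because
  \<open>S T\<close> has finite rank and \<open>ker T\<close> almost lies in \<open>range S\<close>. In the same way, the finite rank of \<open>T S\<close>
  and the inclusion, up to finite dimension, of \<open>ker S\<close> in \<open>range T\<close> give the finite codimension of
  the range of \<open>V\<close>.\<close>

lemma fredholm_pair_outer_inverses:
  fixes sc1 :: "'k::real_or_complex \<Rightarrow> 'a::banach \<Rightarrow> 'a" and sc2 :: "'k \<Rightarrow> 'b::banach \<Rightarrow> 'b"
    and ip1 :: "'a \<Rightarrow> 'a \<Rightarrow> 'k" and ip2 :: "'b \<Rightarrow> 'b \<Rightarrow> 'k"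
    and S :: "'a \<Rightarrow>\<^sub>L 'b" and T :: "'b \<Rightarrow>\<^sub>L 'a"
  assumes h1: "hilbert_space sc1 ip1" and h2: "hilbert_space sc2 ip2"
    and fred: "fredholm_pair sc1 sc2 S T"
  obtains T' :: "'a \<Rightarrow>\<^sub>L 'b" and V :: "'b \<Rightarrow>\<^sub>L 'a"
  where "T' \<in> bounded_operators sc1 sc2" "\<And>x. T' (T (T' x)) = T' x"
    "V \<in> bounded_operators sc2 sc1" "\<And>y. V ((S + T') (V y)) = V y"
    "linear_space.almost_in sc2 {y. V y = 0} {0}" "linear_space.almost_in sc1 UNIV (range V)"
proof -
  interpret h1: hilbert_space sc1 ip1 by fact
  interpret h2: hilbert_space sc2 ip2 by fact
  interpret fwd: linear_space_pair sc1 sc2 ..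
  interpret bwd: linear_space_pair sc2 sc1 ..
  interpret end1: linear_space_pair sc1 sc1 ..
  interpret end2: linear_space_pair sc2 sc2 ..
  have ST: "S \<in> bounded_operators sc1 sc2" "T \<in> bounded_operators sc2 sc1"
    and com: "h1.commensurable {x. S x = 0} (range T)" "h2.commensurable {y. T y = 0} (range S)"
    using fred fredholm_pair_iff_commensurable_pair(1)[OF fwd.linear_space_pair_axioms]
    by (auto simp: fwd.commensurable_pair_def)
  obtain T' where T': "T' \<in> bounded_operators sc1 sc2" "\<And>x. T' (T (T' x)) = T' x"
    "\<And>x. S (T (T' x)) = 0" "\<And>x y. T y = 0 \<Longrightarrow> ip2 (T' x) y = 0"
    "\<And>y. S (T y) = 0 \<Longrightarrow> T (T' (T y)) = T y"
    "\<And>x. (\<And>z. S z = 0 \<Longrightarrow> ip1 x z = 0) \<Longrightarrow> T' x = 0"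
    using exists_bounded_outer_inverse[OF h1 h2 ST] com by (auto simp: h1.commensurable_def)
  obtain S' where S': "S' \<in> bounded_operators sc2 sc1" "\<And>x. S' (S (S' x)) = S' x"
    "\<And>x. T (S (S' x)) = 0" "\<And>x y. S y = 0 \<Longrightarrow> ip1 (S' x) y = 0"
    "\<And>y. T (S y) = 0 \<Longrightarrow> S (S' (S y)) = S y"
    "\<And>x. (\<And>z. T z = 0 \<Longrightarrow> ip2 x z = 0) \<Longrightarrow> S' x = 0"
    using exists_bounded_outer_inverse[OF h2 h1 ST(2,1)] com by (auto simp: h2.commensurable_def)
  have T'S': "T' (S' y) = 0" and S'T': "S' (T' x) = 0" for x y
    using T'(4,6) S'(4,6) by blast+
  define V where "V = S' + (T o\<^sub>L T' o\<^sub>L T)"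
  define U where "U = S + T'"
  have V_apply: "V y = S' y + T (T' (T y))" and U_apply: "U x = S x + T' x" for x y
    by (simp_all add: V_def U_def blinfun.add_left)
  have V: "V \<in> bounded_operators sc2 sc1"
    unfolding V_def using S'(1) T'(1) ST
    by (intro bounded_operators_add bounded_operators_compose h1.vector_space_axioms h2.vector_space_axioms)
  have UV: "U (V y) = S (S' y) + T' (T y)" for y
    by (simp add: V_apply U_apply blinfun.add_right T' T'S' blinfun.zero_right)
  have VUV: "V (U (V y)) = V y" for y
    by (simp add: UV) (simp add: V_apply blinfun.add_right S' S'T' T' blinfun.zero_right)
  have linS: "Vector_Spaces.linear sc1 sc2 (blinfun_apply S)"
    and linT: "Vector_Spaces.linear sc2 sc1 (blinfun_apply T)"
    and linV: "Vector_Spaces.linear sc2 sc1 (blinfun_apply V)"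
    and linT': "Vector_Spaces.linear sc1 sc2 (blinfun_apply T')"
    and linS': "Vector_Spaces.linear sc2 sc1 (blinfun_apply S')"
    using ST T'(1) S'(1) V h1.vector_space_axioms h2.vector_space_axioms
    by (auto intro: linear_of_bounded_operators)
  have linST: "Vector_Spaces.linear sc2 sc2 (\<lambda>y. S (T y))"
    and linTS: "Vector_Spaces.linear sc1 sc1 (\<lambda>x. T (S x))"
    using Vector_Spaces.linear_compose[OF linT linS] Vector_Spaces.linear_compose[OF linS linT]
    by (simp_all add: o_def)
  \<comment> \<open>On this space \<open>V\<close> is injective, so that its finite codimension bounds the kernel of \<open>V\<close>.\<close>
  define Fix where "Fix = {y. U (V y) = y}"
  have subFix: "h2.subspace Fix"
  proof -
    have "Vector_Spaces.linear sc2 sc2 (\<lambda>y. S (S' y) + T' (T y))"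
      using end2.linear_compose_add[OF Vector_Spaces.linear_compose[OF linS' linS]
          Vector_Spaces.linear_compose[OF linT linT']]
      by (simp add: o_def)
    from end2.linear_subspaces(1)[OF end2.linear_compose_sub[OF this h2.linear_id[unfolded id_def]]]
    show ?thesis by (simp add: Fix_def UV)
  qed
  have NT_Fix: "h2.almost_in {y. T y = 0} Fix"
  proof -
    have "h2.almost_in {y. T y = 0} ({y. T y = 0} \<inter> range S)"
      using com(2) bwd.linear_subspaces(1)[OF linT] fwd.linear_subspaces(2)[OF linS]
      by (intro h2.almost_in_inter) (auto simp: h2.commensurable_def)
    moreover have "{y. T y = 0} \<inter> range S \<subseteq> Fix"
      by (auto simp: Fix_def UV S'(5) blinfun.zero_right)
    ultimately show ?thesis by (rule h2.almost_in_mono[OF _ order_refl])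
  qed
  have "h2.almost_in UNIV {y. S (T y) = 0}"
  proof (rule end2.range_almost_in_kernel[OF linST h2.subspace_UNIV])
    have "h2.almost_in (S ` range T) (S ` {x. S x = 0})"
      using com(1) by (intro fwd.almost_in_image linS) (auto simp: h1.commensurable_def)
    then show "h2.almost_in (range (\<lambda>y. S (T y))) {0}"
      by (rule h2.almost_in_mono) auto
  qed
  moreover have "h2.almost_in {y. S (T y) = 0} ({y. T y = 0} \<union> Fix)"
  proof -
    have "{y. S (T y) = 0} \<subseteq> h2.span ({y. T y = 0} \<union> Fix)"
    proof
      fix y assume "y \<in> {y. S (T y) = 0}"
      then have "y - T' (T y) \<in> {y. T y = 0}" by (simp add: blinfun.diff_right T'(5))
      moreover have "T' (T y) \<in> Fix" by (simp add: Fix_def UV T'(2) S'T' blinfun.zero_right)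
      ultimately have "(y - T' (T y)) + T' (T y) \<in> h2.span ({y. T y = 0} \<union> Fix)"
        by (intro h2.span_add h2.span_base) auto
      then show "y \<in> h2.span ({y. T y = 0} \<union> Fix)" by simp
    qed
    then show ?thesis by (rule h2.almost_in_mono[OF h2.almost_in_span _ order_refl])
  qed
  ultimately have "h2.almost_in UNIV Fix"
    using h2.almost_in_Un[OF NT_Fix h2.almost_in_subset[OF order_refl]] h2.almost_in_trans by metis
  then have "h2.almost_in {y. V y = 0} Fix"
    by (rule h2.almost_in_mono) auto
  then have "h2.almost_in {y. V y = 0} ({y. V y = 0} \<inter> Fix)"
    by (intro h2.almost_in_inter subFix bwd.linear_subspaces(1)[OF linV])
  moreover have "{y. V y = 0} \<inter> Fix \<subseteq> {0}" by (auto simp: Fix_def blinfun.zero_right)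
  ultimately have kerV: "h2.almost_in {y. V y = 0} {0}" by (rule h2.almost_in_mono[OF _ order_refl])

  have S'_range: "S' y \<in> range V" for y
  proof -
    have "V (S (S' y)) = S' y" by (simp add: V_apply S' T' blinfun.zero_right)
    then show ?thesis by (metis rangeI)
  qed
  have NS_range: "h1.almost_in {x. S x = 0} (range V)"
  proof -
    have "h1.almost_in {x. S x = 0} ({x. S x = 0} \<inter> range T)"
      using com(1) fwd.linear_subspaces(1)[OF linS] bwd.linear_subspaces(2)[OF linT]
      by (intro h1.almost_in_inter) (auto simp: h1.commensurable_def)
    moreover have "{x. S x = 0} \<inter> range T \<subseteq> range V"
    proof
      fix x assume "x \<in> {x. S x = 0} \<inter> range T"
      then have "T (T' x) = x" using T'(5) by auto
      then have "V (T' x) = x" by (simp add: V_apply S'T')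
      then show "x \<in> range V" by (metis rangeI)
    qed
    ultimately show ?thesis by (rule h1.almost_in_mono[OF _ order_refl])
  qed
  have "h1.almost_in UNIV {x. T (S x) = 0}"
  proof (rule end1.range_almost_in_kernel[OF linTS h1.subspace_UNIV])
    have "h1.almost_in (T ` range S) (T ` {y. T y = 0})"
      using com(2) by (intro bwd.almost_in_image linT) (auto simp: h2.commensurable_def)
    then show "h1.almost_in (range (\<lambda>x. T (S x))) {0}"
      by (rule h1.almost_in_mono) auto
  qed
  moreover have "h1.almost_in {x. T (S x) = 0} ({x. S x = 0} \<union> range V)"
  proof -
    have "{x. T (S x) = 0} \<subseteq> h1.span ({x. S x = 0} \<union> range V)"
    proof
      fix x assume "x \<in> {x. T (S x) = 0}"
      then have "x - S' (S x) \<in> {x. S x = 0}" by (simp add: blinfun.diff_right S'(5))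
      then have "(x - S' (S x)) + S' (S x) \<in> h1.span ({x. S x = 0} \<union> range V)"
        using S'_range by (intro h1.span_add h1.span_base) auto
      then show "x \<in> h1.span ({x. S x = 0} \<union> range V)" by simp
    qed
    then show ?thesis by (rule h1.almost_in_mono[OF h1.almost_in_span _ order_refl])
  qed
  ultimately have ranV: "h1.almost_in UNIV (range V)"
    using h1.almost_in_Un[OF NS_range h1.almost_in_subset[OF order_refl]] h1.almost_in_trans by metis
  show ?thesis
    by (rule that[OF T'(1,2) V VUV[unfolded U_def] kerV ranV])
qed

section \<open>Stability of the index of a Fredholm pair\<close>

theorem theorem5p1:
  fixes sc1 :: "'k::real_or_complex \<Rightarrow> 'a::banach \<Rightarrow> 'a"
    and sc2 :: "'k \<Rightarrow> 'b::banach \<Rightarrow> 'b"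
    and ip1 :: "'a \<Rightarrow> 'a \<Rightarrow> 'k"
    and ip2 :: "'b \<Rightarrow> 'b \<Rightarrow> 'k"
    and S :: "'a \<Rightarrow>\<^sub>L 'b"
    and T :: "'b \<Rightarrow>\<^sub>L 'a"
  assumes "hilbert_space sc1 ip1"
    and "hilbert_space sc2 ip2"
    and "fredholm_pair sc1 sc2 S T"
  shows "\<exists>\<epsilon>>0. \<forall>S1 \<in> bounded_operators sc1 sc2. \<forall>T1 \<in> bounded_operators sc2 sc1.
           finite_dimensional sc1 (range_space (T1 o\<^sub>L S1)) \<longrightarrow>
           finite_dimensional sc2 (range_space (S1 o\<^sub>L T1)) \<longrightarrow>
           norm (S - S1) < \<epsilon> \<longrightarrow> norm (T - T1) < \<epsilon> \<longrightarrow>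
           fredholm_pair sc1 sc2 S1 T1 \<and>
           fredholm_index sc1 sc2 S T = fredholm_index sc1 sc2 S1 T1"
proof -
  interpret h1: hilbert_space sc1 ip1 by fact
  interpret h2: hilbert_space sc2 ip2 by fact
  interpret fwd: linear_space_pair sc1 sc2 ..
  interpret bwd: linear_space_pair sc2 sc1 ..
  have vs: "vector_space sc1" "vector_space sc2" by unfold_locales
  note pair_iff = fredholm_pair_iff_commensurable_pair[OF fwd.linear_space_pair_axioms]
  have S: "S \<in> bounded_operators sc1 sc2" and T: "T \<in> bounded_operators sc2 sc1"
    and com: "h1.commensurable {x. S x = 0} (range T)" "h2.commensurable {y. T y = 0} (range S)"
    using assms(3) pair_iff(1) by (auto simp: fwd.commensurable_pair_def)
  obtain T' V where T': "T' \<in> bounded_operators sc1 sc2" "\<And>x. T' (T (T' x)) = T' x"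
    and V: "V \<in> bounded_operators sc2 sc1" "\<And>y. V ((S + T') (V y)) = V y"
    and kerV: "h2.almost_in {y. V y = 0} {0}" and ranV: "h1.almost_in UNIV (range V)"
    using fredholm_pair_outer_inverses[OF assms] by blast
  note lin = linear_of_bounded_operators[OF vs] linear_of_bounded_operators[OF vs(2,1)]
  \<comment> \<open>Every pair that admits outer inverses with the null space and the range of this \<open>V\<close> has
    index \<open>n\<close>. This applies to \<open>(S, T)\<close> itself and to all pairs near it.\<close>
  define n where "n = int (h1.relative_dim UNIV (range V)) - int (h2.relative_dim {y. V y = 0} {0})"

  have pair: "fredholm_pair sc1 sc2 S1 T1 \<and> fredholm_index sc1 sc2 S1 T1 = n"
    if S1: "S1 \<in> bounded_operators sc1 sc2" and T1: "T1 \<in> bounded_operators sc2 sc1"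
      and T1': "T1' \<in> bounded_operators sc1 sc2" "\<And>x. T1' (T1 (T1' x)) = T1' x"
      and V1: "V1 \<in> bounded_operators sc2 sc1" "\<And>y. V1 ((S1 + T1') (V1 y)) = V1 y"
        "{y. blinfun_apply V1 y = 0} = {y. V y = 0}" "range (blinfun_apply V1) = range V"
      and fin: "h2.almost_in (range (\<lambda>y. S1 (T1 y))) {0}" "h1.almost_in (range (\<lambda>x. T1 (S1 x))) {0}"
    for S1 T1 T1' V1
  proof -
    have linU1: "Vector_Spaces.linear sc1 sc2 (\<lambda>x. S1 x + T1' x)"
      by (rule fwd.linear_compose_add[OF lin(1)[OF S1] lin(1)[OF T1'(1)]])
    have VUV: "V1 (S1 (V1 y) + T1' (V1 y)) = V1 y" for y
      using V1(2)[of y] by (simp add: blinfun.add_left)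
    note U1 = fwd.map_index_outer_inverse[OF linU1 lin(2)[OF V1(1)] VUV, unfolded V1(3,4), OF kerV ranV]
    note P = fwd.pair_index_eq_map_index[OF lin(1)[OF S1] lin(2)[OF T1] lin(1)[OF T1'(1)] fin T1'(2) U1(1)]
    have "fredholm_pair sc1 sc2 S1 T1" using pair_iff(1) S1 T1 P(1) by blast
    then show ?thesis using pair_iff(2) P(2) U1(2) by (simp add: n_def)
  qed

  have finST: "h2.almost_in (range (\<lambda>y. S (T y))) {0}" "h1.almost_in (range (\<lambda>x. T (S x))) {0}"
  proof -
    have "h2.almost_in (S ` range T) (S ` {x. S x = 0})"
      using com by (intro fwd.almost_in_image lin S) (auto simp: h1.commensurable_def)
    then show "h2.almost_in (range (\<lambda>y. S (T y))) {0}"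
      by (rule h2.almost_in_mono) auto
    have "h1.almost_in (T ` range S) (T ` {y. T y = 0})"
      using com by (intro bwd.almost_in_image lin T) (auto simp: h2.commensurable_def)
    then show "h1.almost_in (range (\<lambda>x. T (S x))) {0}"
      by (rule h1.almost_in_mono) auto
  qed
  have index: "fredholm_index sc1 sc2 S T = n"
    using pair[OF S T T' V refl refl finST] by simp

  \<comment> \<open>The bound has to make both perturbation steps possible: \<open>t * \<epsilon> \<le> 1 / 2\<close> for passing from
    \<open>T'\<close> to \<open>T1'\<close>, after which \<open>S + T'\<close> has moved by at most \<open>\<epsilon> + 2 * t\<^sup>2 * \<epsilon>\<close>, and \<open>v\<close> times this
    distance at most \<open>1 / 2\<close> for passing from \<open>V\<close> to \<open>V1\<close>.\<close>
  define t where "t = norm T' + 1"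
  define v where "v = norm V + 1"
  define \<epsilon> where "\<epsilon> = 1 / (2 * v * (1 + 2 * t\<^sup>2))"
  have tv: "t \<ge> 1" "v \<ge> 1" by (simp_all add: t_def v_def)
  have pos: "1 + 2 * t\<^sup>2 > 0" by (simp add: add_pos_nonneg)
  have "\<epsilon> > 0" using tv pos by (simp add: \<epsilon>_def)
  have v_eps: "v * (\<epsilon> * (1 + 2 * t\<^sup>2)) = 1 / 2" using tv pos by (simp add: \<epsilon>_def)
  have t_eps: "t * \<epsilon> \<le> 1 / 2"
  proof -
    have "t \<le> 1 + 2 * t\<^sup>2" 
      using mult_left_mono[of 1 t t] tv(1) unfolding power2_eq_square by linarith
    then have "t * \<epsilon> \<le> \<epsilon> * (1 + 2 * t\<^sup>2)" using \<open>\<epsilon> > 0\<close> by (simp add: mult.commute)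
    also have "\<dots> \<le> v * (\<epsilon> * (1 + 2 * t\<^sup>2))"
      using mult_right_mono[OF tv(2), of "\<epsilon> * (1 + 2 * t\<^sup>2)"] \<open>\<epsilon> > 0\<close> pos by simp
    finally show ?thesis using v_eps by simp
  qed
  have "fredholm_pair sc1 sc2 S1 T1 \<and> fredholm_index sc1 sc2 S T = fredholm_index sc1 sc2 S1 T1"
    if S1: "S1 \<in> bounded_operators sc1 sc2" and T1: "T1 \<in> bounded_operators sc2 sc1"
      and fin: "finite_dimensional sc1 (range_space (T1 o\<^sub>L S1))"
        "finite_dimensional sc2 (range_space (S1 o\<^sub>L T1))"
      and close: "norm (S - S1) < \<epsilon>" "norm (T - T1) < \<epsilon>"
    for S1 T1
  proof -
    have "norm T' * norm (T - T1) \<le> t * \<epsilon>"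
      using close(2) by (intro mult_mono) (auto simp: t_def)
    then have "norm T' * norm (T - T1) \<le> 1 / 2" using t_eps by simp
    then obtain T1' where T1': "T1' \<in> bounded_operators sc1 sc2" "\<And>x. T1' (T1 (T1' x)) = T1' x"
      and "{x. blinfun_apply T1' x = 0} = {x. T' x = 0}" "range (blinfun_apply T1') = range T'"
      and diff: "norm (T' - T1') \<le> 2 * (norm T')\<^sup>2 * norm (T - T1)"
      by (rule outer_inverse_perturbation[OF vs(2,1) T T1 T']) (rule that)
    have "norm ((S + T') - (S1 + T1')) \<le> norm (S - S1) + norm (T' - T1')"
      using norm_triangle_ineq[of "S - S1" "T' - T1'"] by (simp add: algebra_simps)
    also have "\<dots> \<le> \<epsilon> + 2 * t\<^sup>2 * \<epsilon>"
    proof (intro add_mono)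
      have "2 * (norm T')\<^sup>2 * norm (T - T1) \<le> 2 * t\<^sup>2 * \<epsilon>"
        using close(2) by (intro mult_mono power_mono) (auto simp: t_def)
      then show "norm (T' - T1') \<le> 2 * t\<^sup>2 * \<epsilon>" using diff by simp
    qed (use close in simp)
    finally have "norm V * norm ((S + T') - (S1 + T1')) \<le> v * (\<epsilon> * (1 + 2 * t\<^sup>2))"
      by (intro mult_mono) (auto simp: v_def algebra_simps)
    then have "norm V * norm ((S + T') - (S1 + T1')) \<le> 1 / 2" using v_eps by simp
    then obtain V1 where V1: "V1 \<in> bounded_operators sc2 sc1" "\<And>y. V1 ((S1 + T1') (V1 y)) = V1 y"
      "{y. blinfun_apply V1 y = 0} = {y. V y = 0}" "range (blinfun_apply V1) = range V"
      "norm (V - V1) \<le> 2 * (norm V)\<^sup>2 * norm ((S + T') - (S1 + T1'))"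
      by (rule outer_inverse_perturbation[OF vs bounded_operators_add[OF vs S T'(1)]
          bounded_operators_add[OF vs S1 T1'(1)] V]) (rule that)
    have "h2.almost_in (range (\<lambda>y. S1 (T1 y))) {0}" "h1.almost_in (range (\<lambda>x. T1 (S1 x))) {0}"
      using h1.finite_dimensional_almost_in[OF fin(1)] h2.finite_dimensional_almost_in[OF fin(2)]
      by (simp_all add: range_space_def)
    from pair[OF S1 T1 T1' V1(1-4) this] show ?thesis using index by simp
  qed
  then show ?thesis using \<open>\<epsilon> > 0\<close> by blast
qed

end
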